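(* Let $0<q<1$, $n\in\mathbb{N}$, and $\pi\sim\mathrm{Maj}(n,q)$. Let $c_1(\pi)$ be the number of fixed points and $c_2(\pi)$ the number of $2$-cycles of $\pi$. Then \[ \mathbb{E}[c_1(\pi)]=\sum_{\ell=1}^n\frac{(1-q)^{\ell-1}}{[\ell]_q},\qquad \mathrm{Var}[c_1(\pi)]\xrightarrow[n\to\infty]{}\sum_{\ell\ge1}\frac{\ell(1-q)^{\ell-1}}{[\ell]_q},\qquad \mathbb{E}[c_2(\pi)]=\sum_{\ell=1}^{\lfloor n/2\rfloor}\frac{q^\ell(1-q)^{2\ell-2}}{[\ell]_q[2\ell]_q}. \]
   Context: $\mathrm{Maj}(n,q)$ is the distribution on $\mathfrak{S}_n$ with $\mathbb{P}(\mathrm{Maj}(n,q)=\pi)=q^{\mathrm{maj}(\pi)}/[n]_q!$, where $\mathrm{maj}(\pi)=\sum_{i:\pi(i)>\pi(i+1)} i$, $[m]_q=1+q+\dots+q^{m-1}$, and $[n]_q!=\prod_{m=1}^n[m]_q$. *)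

theory Defs
  imports "HOL-Probability.Probability" "HOL-Combinatorics.Permutations"
begin

definition maj :: "nat \<Rightarrow> (nat \<Rightarrow> nat) \<Rightarrow> nat" where
  "maj n \<pi> = (\<Sum>i | i \<in> {1..<n} \<and> \<pi> i > \<pi> (i + 1). i)"

definition q_int :: "real \<Rightarrow> nat \<Rightarrow> real" where
  "q_int q m = (\<Sum>i<m. q ^ i)"

definition q_fact :: "real \<Rightarrow> nat \<Rightarrow> real" where
  "q_fact q n = (\<Prod>m=1..n. q_int q m)"

definition Maj :: "nat \<Rightarrow> real \<Rightarrow> (nat \<Rightarrow> nat) pmf" where
  "Maj n q = embed_pmf (\<lambda>\<pi>. if \<pi> permutes {1..n} then q ^ maj n \<pi> / q_fact q n else 0)"

definition fixed_points :: "nat \<Rightarrow> (nat \<Rightarrow> nat) \<Rightarrow> nat" where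
  "fixed_points n \<pi> = card {i \<in> {1..n}. \<pi> i = i}"

text \<open>A 2-cycle is identified with its underlying two-element set, so that the cycles (i j)
  and (j i) are counted once.\<close>

definition two_cycles :: "nat \<Rightarrow> (nat \<Rightarrow> nat) \<Rightarrow> nat" where
  "two_cycles n \<pi> =
     card {{i, j} | i j. i \<in> {1..n} \<and> j \<in> {1..n} \<and> i \<noteq> j \<and> \<pi> i = j \<and> \<pi> j = i}"

text \<open>The weights defining \<^const>\<open>Maj\<close> sum to 1 (MacMahon). The proof refines the sum by the
  last value: \<open>lastshift n k\<close> maps the last position to \<open>k\<close> and is increasing on the others, and
  composing with it gives a bijection from the permutations of \<open>{1..n}\<close> to the permutations of
  \<open>{1..n+1}\<close> with last value \<open>k\<close>.\<close>

definition lastshift :: "nat \<Rightarrow> nat \<Rightarrow> nat \<Rightarrow> nat" where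
  "lastshift n k i = (if i = Suc n then k else if k \<le> i \<and> i \<le> n then Suc i else i)"

lemma lastshift_permutes:
  assumes "k \<in> {1..Suc n}"
  shows "lastshift n k permutes {1..Suc n}"
proof (rule bij_imp_permutes)
  have inj: "inj_on (lastshift n k) {1..Suc n}"
    using assms by (auto simp: inj_on_def lastshift_def split: if_splits)
  have sub: "lastshift n k ` {1..Suc n} \<subseteq> {1..Suc n}"
    using assms by (auto simp: lastshift_def)
  show "bij_betw (lastshift n k) {1..Suc n} {1..Suc n}"
    using inj sub by (simp add: bij_betw_def endo_inj_surj)
qed (use assms in \<open>auto simp: lastshift_def\<close>)

lemma bij_betw_lastshift:
  assumes k: "k \<in> {1..Suc n}"
  shows "bij_betw (\<lambda>\<sigma>. lastshift n k \<circ> \<sigma>) {\<sigma>. \<sigma> permutes {1..n}}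
           {\<pi>. \<pi> permutes {1..Suc n} \<and> \<pi> (Suc n) = k}"
proof -
  note L = lastshift_permutes[OF k]
  have 1: "lastshift n k \<circ> \<sigma> permutes {1..Suc n} \<and> (lastshift n k \<circ> \<sigma>) (Suc n) = k"
    if "\<sigma> permutes {1..n}" for \<sigma>
  proof -
    have "\<sigma> permutes {1..Suc n}" by (rule permutes_subset[OF that]) auto
    moreover have "\<sigma> (Suc n) = Suc n" using that by (auto simp: permutes_def)
    ultimately show ?thesis using L by (auto intro: permutes_compose simp: lastshift_def)
  qed
  have 2: "inv (lastshift n k) \<circ> \<pi> permutes {1..n}"
    if "\<pi> permutes {1..Suc n}" "\<pi> (Suc n) = k" for \<pi>
  proof -
    have p: "inv (lastshift n k) \<circ> \<pi> permutes {1..Suc n}"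
      using that L by (intro permutes_compose permutes_inv)
    have "lastshift n k (Suc n) = k" by (simp add: lastshift_def)
    hence "(inv (lastshift n k) \<circ> \<pi>) (Suc n) = Suc n"
      using that permutes_inverses(2)[OF L, of "Suc n"] by simp
    with p show ?thesis
      by (intro permutes_superset[OF p]) (auto simp: le_Suc_eq)
  qed
  show ?thesis
    by (rule bij_betw_byWitness[where f' = "\<lambda>\<pi>. inv (lastshift n k) \<circ> \<pi>"])
       (use 1 2 permutes_inv_o[OF L] in \<open>auto simp: o_assoc simp del: o_apply\<close>)
qed

lemma maj_lastshift:
  assumes k: "k \<in> {1..Suc n}" and s: "\<sigma> permutes {1..n}" and n: "n > 0"
  shows "maj (Suc n) (lastshift n k \<circ> \<sigma>) = maj n \<sigma> + (if k \<le> \<sigma> n then n else 0)"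
proof -
  have r: "\<sigma> i \<in> {1..n}" if "i \<in> {1..n}" for i
    using permutes_in_image[OF s] that by blast
  have mono: "lastshift n k (\<sigma> (i + 1)) < lastshift n k (\<sigma> i) \<longleftrightarrow> \<sigma> (i + 1) < \<sigma> i"
    if "i \<in> {1..<n}" for i
    using r[of i] r[of "i + 1"] that by (auto simp: lastshift_def)
  have s1: "\<sigma> (Suc n) = Suc n" using s by (auto simp: permutes_def)
  have last: "lastshift n k (\<sigma> (Suc n)) < lastshift n k (\<sigma> n) \<longleftrightarrow> k \<le> \<sigma> n"
    using r[of n] n by (auto simp: s1 lastshift_def)
  have "{i. i \<in> {1..<Suc n} \<and> (lastshift n k \<circ> \<sigma>) i > (lastshift n k \<circ> \<sigma>) (i + 1)}
      = {i. i \<in> {1..<n} \<and> \<sigma> i > \<sigma> (i + 1)} \<union> (if k \<le> \<sigma> n then {n} else {})"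
    using mono last n by (auto simp: less_Suc_eq)
  thus ?thesis by (auto simp: maj_def)
qed

lemma q_int_add: "q_int q (a + b) = q_int q a + q ^ a * q_int q b"
  by (induction b) (auto simp: q_int_def power_add algebra_simps)

lemma sum_rev_power: "k \<le> n \<Longrightarrow> (\<Sum>j=Suc k..n. q ^ (n - j)) = q_int q (n - k)"
  unfolding q_int_def
  by (rule sum.reindex_bij_witness[of _ "\<lambda>i. n - i" "\<lambda>j. n - j"]) auto

lemma sum_q_maj_last:
  assumes "k \<in> {1..Suc n}"
  shows "(\<Sum>\<pi> | \<pi> permutes {1..Suc n} \<and> \<pi> (Suc n) = k. q ^ maj (Suc n) \<pi>)
           = q ^ (Suc n - k) * q_fact q n"
  using assms
proof (induction n arbitrary: k)
  case 0
  have "{\<pi>. \<pi> permutes {1..Suc 0} \<and> \<pi> (Suc 0) = k} = {id}" using 0 by auto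
  thus ?case using 0 by (simp add: maj_def q_fact_def)
next
  case (Suc n)
  let ?N = "Suc n"
  let ?P = "{\<sigma>. \<sigma> permutes {1..?N}}"
  have fin: "finite ?P" by (simp add: finite_permutations)
  have "(\<Sum>\<pi> | \<pi> permutes {1..Suc ?N} \<and> \<pi> (Suc ?N) = k. q ^ maj (Suc ?N) \<pi>)
      = (\<Sum>\<sigma>\<in>?P. q ^ maj (Suc ?N) (lastshift ?N k \<circ> \<sigma>))"
    by (rule sum.reindex_bij_betw[OF bij_betw_lastshift[OF Suc.prems], symmetric])
  also have "\<dots> = (\<Sum>\<sigma>\<in>?P. q ^ maj ?N \<sigma> * (if k \<le> \<sigma> ?N then q ^ ?N else 1))"
    by (rule sum.cong) (auto simp: maj_lastshift[OF Suc.prems] power_add)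
  also have "\<dots> = (\<Sum>j\<in>{1..?N}. \<Sum>\<sigma>\<in>{\<sigma>\<in>?P. \<sigma> ?N = j}. q ^ maj ?N \<sigma> * (if k \<le> \<sigma> ?N then q ^ ?N else 1))"
    by (rule sum.group[symmetric, OF fin]) (use permutes_in_image in fastforce)+
  also have "\<dots> = (\<Sum>j\<in>{1..?N}. (q ^ (?N - j) * q_fact q n) * (if k \<le> j then q ^ ?N else 1))"
  proof (rule sum.cong)
    fix j assume "j \<in> {1..?N}"
    from Suc.IH[OF this] show "(\<Sum>\<sigma>\<in>{\<sigma>\<in>?P. \<sigma> ?N = j}. q ^ maj ?N \<sigma> * (if k \<le> \<sigma> ?N then q ^ ?N else 1))
      = (q ^ (?N - j) * q_fact q n) * (if k \<le> j then q ^ ?N else 1)"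
      by (simp flip: sum_distrib_right)
  qed simp
  also have "\<dots> = (\<Sum>j\<in>{1..k-1}. (q ^ (?N - j) * q_fact q n)) + (\<Sum>j\<in>{k..?N}. (q ^ (?N - j) * q_fact q n) * q ^ ?N)"
  proof -
    have "{1..?N} = {1..k-1} \<union> {k..?N}" "{1..k-1} \<inter> {k..?N} = {}" using Suc.prems by auto
    thus ?thesis using Suc.prems by (auto simp: sum.union_disjoint intro!: arg_cong2[of _ _ _ _ "(+)"] sum.cong)
  qed
  also have "\<dots> = q_fact q n * (q ^ (?N - (k - 1)) * q_int q (k - 1) + q ^ ?N * q_int q (?N - (k - 1)))"
  proof -
    have "(\<Sum>j\<in>{1..k-1}. q ^ (?N - j)) = (\<Sum>j\<in>{1..k-1}. q ^ (?N - (k - 1)) * q ^ (k - 1 - j))"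
    proof (intro sum.cong refl)
      fix j assume "j \<in> {1..k-1}"
      hence "?N - j = (?N - (k - 1)) + (k - 1 - j)" using Suc.prems by auto
      thus "q ^ (?N - j) = q ^ (?N - (k - 1)) * q ^ (k - 1 - j)" by (metis power_add)
    qed
    also have "\<dots> = q ^ (?N - (k - 1)) * q_int q (k - 1)"
      using sum_rev_power[of 0 "k - 1" q] by (simp flip: sum_distrib_left)
    finally have A: "(\<Sum>j\<in>{1..k-1}. q ^ (?N - j)) = q ^ (?N - (k - 1)) * q_int q (k - 1)" .
    have B: "(\<Sum>j\<in>{k..?N}. q ^ (?N - j)) = q_int q (?N - (k - 1))"
    proof -
      have "Suc (k - 1) = k" "k - 1 \<le> ?N" using Suc.prems by auto
      thus ?thesis using sum_rev_power[of "k - 1" ?N q] by (simp only:)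
    qed
    show ?thesis by (simp only: sum_distrib_right[symmetric] A B) (simp only: algebra_simps)
  qed
  also have "\<dots> = q ^ (Suc ?N - k) * (q_fact q n * q_int q ?N)"
  proof -
    have e: "Suc ?N - k = ?N - (k - 1)" "?N = (?N - (k - 1)) + (k - 1)" using Suc.prems by auto
    have "q ^ ?N = q ^ (?N - (k - 1)) * q ^ (k - 1)" using e(2) by (metis power_add)
    moreover have "q_int q ?N = q_int q (k - 1) + q ^ (k - 1) * q_int q (?N - (k - 1))"
      using e(2) q_int_add[of q "k - 1" "?N - (k - 1)"] by (simp add: add.commute)
    ultimately show ?thesis unfolding e(1) by (simp only: algebra_simps)
  qed
  also have "q_fact q n * q_int q ?N = q_fact q ?N" by (simp add: q_fact_def)
  finally show ?case .
qed

lemma sum_q_maj: "(\<Sum>\<pi> | \<pi> permutes {1..n}. q ^ maj n \<pi>) = q_fact q n"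
proof (cases n)
  case 0
  thus ?thesis by (simp add: maj_def q_fact_def)
next
  case (Suc m)
  let ?P = "{\<pi>. \<pi> permutes {1..Suc m}}"
  have fin: "finite ?P" by (simp add: finite_permutations)
  have "(\<Sum>\<pi>\<in>?P. q ^ maj (Suc m) \<pi>) = (\<Sum>k\<in>{1..Suc m}. \<Sum>\<pi>\<in>{\<pi>\<in>?P. \<pi> (Suc m) = k}. q ^ maj (Suc m) \<pi>)"
    by (rule sum.group[symmetric, OF fin]) (use permutes_in_image in fastforce)+
  also have "\<dots> = (\<Sum>k=1..Suc m. q ^ (Suc m - k) * q_fact q m)"
    using sum_q_maj_last by (intro sum.cong) auto
  also have "\<dots> = q_fact q (Suc m)"
    using sum_rev_power[of 0 "Suc m" q]
    by (simp add: q_fact_def mult.commute flip: sum_distrib_right)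
  finally show ?thesis by (simp add: Suc)
qed

lemma q_fact_pos: "q > 0 \<Longrightarrow> q_fact q n > 0"
  unfolding q_fact_def q_int_def by (intro prod_pos ballI sum_pos) (auto simp: lessThan_empty_iff)

lemma pmf_Maj:
  assumes "q > 0"
  shows "pmf (Maj n q) \<pi> = (if \<pi> permutes {1..n} then q ^ maj n \<pi> / q_fact q n else 0)"
  unfolding Maj_def
proof (rule pmf_embed_pmf)
  let ?f = "\<lambda>\<pi>. if \<pi> permutes {1..n} then q ^ maj n \<pi> / q_fact q n else 0"
  let ?P = "{\<pi>. \<pi> permutes {1..n}}"
  show nn: "0 \<le> ?f x" for x using assms q_fact_pos[OF assms, of n] by auto
  have fin: "finite ?P" by (simp add: finite_permutations)
  have "(\<integral>\<^sup>+x. ennreal (?f x) \<partial>count_space UNIV) = (\<Sum>x\<in>?P. ennreal (?f x))"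
    by (rule nn_integral_count_space'[OF fin]) auto
  also have "\<dots> = ennreal (\<Sum>x\<in>?P. ?f x)" by (rule sum_ennreal) (rule nn)
  also have "(\<Sum>x\<in>?P. ?f x) = 1"
    using q_fact_pos[OF assms, of n] sum_q_maj[of q n] by (simp flip: sum_divide_distrib)
  finally show "(\<integral>\<^sup>+x. ennreal (?f x) \<partial>count_space UNIV) = 1" by simp
qed

end

theory Submission imports Defs begin

text \<open>Write \<open>x\<^sub>a = (1 - q) q\<^sup>a\<close>. If \<open>w\<close> is a word of \<open>n\<close> independent letters, each equal to \<open>a\<close> with
  probability \<open>x\<^sub>a\<close>, then the permutation sending \<open>i\<close> to the position of the \<open>i\<close>-th letter of \<open>w\<close> in the
  stable sort by decreasing letter has the law \<open>Maj(n,q)\<close>. Its fixed points and 2-cycles are those of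
  its inverse, which maps positions to ranks. Let \<open>c\<^sub>a\<close>
  count the fixed points whose letter is \<open>a\<close>. Deleting such a fixed point from \<open>w\<close> leaves a word of
  length \<open>n - 1\<close> whose other fixed points are unchanged, and conversely a word has exactly
  \<open>1 + c\<^sub>a\<close> gaps where inserting \<open>a\<close> creates a fixed point. Hence
  \<open>E\<^sub>n[c\<^sub>a g(c)] = x\<^sub>a E\<^sub>n\<^sub>-\<^sub>1[(1 + c\<^sub>a) g(1 + c)]\<close> for the total number \<open>c\<close> of fixed points, which
  determines the first two moments. The number of 2-cycles with letters \<open>a < b\<close> satisfies
  \<open>E\<^sub>n[c\<^sub>a\<^sub>b] = x\<^sub>a x\<^sub>b E\<^sub>n\<^sub>-\<^sub>2[1 + c\<^sub>a\<^sub>b]\<close> in the same way. Summing over the letters produces the power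
  sums of the \<open>x\<^sub>a\<close>; this is the part of the Gessel-Reutenauer bijection needed for short cycles.\<close>

section \<open>Ranks of positions in a word\<close>

definition wrank :: "'a::linorder list \<Rightarrow> 'a \<Rightarrow> nat \<Rightarrow> nat" where
  "wrank w a i = length (filter (\<lambda>x. a < x) w) + count_list (take i w) a"

text \<open>The number of positions preceding the letter \<open>a\<close> placed at position \<open>i\<close>, for the order of
  positions by decreasing letter and then from left to right. For \<open>w ! i = a\<close> this is the 0-based
  rank of position \<open>i\<close>; other values of \<open>a\<close> serve to insert a letter.\<close>

definition fix_letter :: "'a::linorder list \<Rightarrow> 'a \<Rightarrow> nat" where
  "fix_letter w a = card {i. i < length w \<and> w ! i = a \<and> wrank w a i = i}"

definition fix_word :: "'a::linorder list \<Rightarrow> nat" where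
  "fix_word w = card {i. i < length w \<and> wrank w (w ! i) i = i}"

text \<open>The 2-cycles of the map from positions to ranks, each represented by its position with
  letter \<open>a\<close>. For distinct \<open>a\<close> and \<open>b\<close> every such cycle is
  counted once.\<close>

definition swap_letters :: "'a::linorder list \<Rightarrow> 'a \<Rightarrow> 'a \<Rightarrow> nat" where
  "swap_letters w a b = card {i. i < length w \<and> w ! i = a \<and> wrank w a i < length w \<and>
     w ! wrank w a i = b \<and> wrank w b (wrank w a i) = i}"

definition insert_at :: "nat \<Rightarrow> 'a \<Rightarrow> 'a list \<Rightarrow> 'a list" where
  "insert_at i a w = take i w @ a # drop i w"

text \<open>The increasing enumeration of all indices except \<open>p\<close>: where old indices go
  when a new entry takes index \<open>p\<close>. It serves for positions and for ranks
  alike.\<close>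

definition shift :: "nat \<Rightarrow> nat \<Rightarrow> nat" where
  "shift p j = (if j < p then j else Suc j)"

lemma wrank_Suc: "i < length w \<Longrightarrow> wrank w a (Suc i) = wrank w a i + of_bool (w ! i = a)"
  by (simp add: wrank_def take_Suc_conv_app_nth)

lemma wrank_mono: "i \<le> j \<Longrightarrow> wrank w a i \<le> wrank w a j"
proof -
  assume "i \<le> j"
  then obtain k where "j = i + k" using le_Suc_ex by blast
  then show ?thesis by (simp add: wrank_def take_add)
qed

lemma wrank_length: "length w \<le> i \<Longrightarrow> wrank w a i = length (filter (\<lambda>x. a \<le> x) w)"
  by (simp add: wrank_def) (induction w, auto)

lemma wrank_le_length: "wrank w a i \<le> length w"
proof -
  have "wrank w a i \<le> wrank w a (max i (length w))" by (rule wrank_mono) simp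
  also have "\<dots> \<le> length w" by (simp add: wrank_length)
  finally show ?thesis .
qed

text \<open>All letters that are at least \<open>b\<close> exceed \<open>a\<close>, so they already
  count towards the rank of \<open>a\<close>, whatever the two positions are.\<close>

lemma wrank_antimono_letter: "a < b \<Longrightarrow> wrank w b j \<le> wrank w a i"
proof -
  assume ab: "a < b"
  have "wrank w b j \<le> wrank w b (max j (length w))" by (rule wrank_mono) simp
  also have "\<dots> = length (filter (\<lambda>x. b \<le> x) w)" by (simp add: wrank_length)
  also have "\<dots> \<le> length (filter (\<lambda>x. a < x) w)" using ab by (induction w) auto
  also have "\<dots> \<le> wrank w a i" by (simp add: wrank_def)
  finally show ?thesis .
qed

lemma wrank_less_length: "i < length w \<Longrightarrow> wrank w (w ! i) i < length w"
  using wrank_Suc[of i w "w ! i"] wrank_le_length[of w "w ! i" "Suc i"] by simp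

text \<open>Position \<open>j\<close> precedes the letter \<open>a\<close> at \<open>i\<close> in
  the sorting order, and stepping past \<open>j\<close> raises the rank of its letter by
  one.\<close>

lemma wrank_less:
  assumes "j < length w" "a < w ! j \<or> a = w ! j \<and> j < i"
  shows "wrank w (w ! j) j < wrank w a i"
proof -
  have "wrank w (w ! j) j < wrank w (w ! j) (Suc j)" using assms(1) by (simp add: wrank_Suc)
  also have "\<dots> \<le> wrank w a i"
    using assms(2) wrank_antimono_letter[of a "w ! j" w "Suc j" i] wrank_mono[of "Suc j" i w a] by auto
  finally show ?thesis .
qed

section \<open>Effect on ranks of inserting one letter\<close>

lemma length_insert_at: "i \<le> length w \<Longrightarrow> length (insert_at i a w) = Suc (length w)"
  by (simp add: insert_at_def)

lemma nth_insert_at: "i \<le> length w \<Longrightarrow> insert_at i a w ! i = a"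
  by (simp add: insert_at_def nth_append)

lemma nth_insert_at_shift:
  assumes "i \<le> length w" "j < length w" shows "insert_at i a w ! shift i j = w ! j"
  using assms by (auto simp: insert_at_def shift_def nth_append)

lemma filter_insert_at: "length (filter P (insert_at i a w)) = length (filter P w) + of_bool (P a)"
proof -
  have "length (filter P w) = length (filter P (take i w @ drop i w))" by simp
  also have "\<dots> = length (filter P (take i w)) + length (filter P (drop i w))"
    by (simp only: filter_append length_append)
  finally show ?thesis by (simp add: insert_at_def)
qed

lemma count_take_insert_at:
  assumes "i \<le> length w"
  shows "count_list (take (shift i j) (insert_at i a w)) b = count_list (take j w) b + of_bool (a = b \<and> i \<le> j)"
proof (cases "j < i")
  case True
  then show ?thesis using assms by (simp add: shift_def insert_at_def)
next
  case False
  then have "take j w = take i w @ take (j - i) (drop i w)"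
    using take_add[of i "j - i" w] by simp
  moreover have "take (Suc j) (insert_at i a w) = take i w @ a # take (j - i) (drop i w)"
    using False assms by (auto simp: insert_at_def Suc_diff_le)
  ultimately show ?thesis using False by (simp add: shift_def)
qed

lemma wrank_insert_at: "i \<le> length w \<Longrightarrow> wrank (insert_at i a w) a i = wrank w a i"
  by (simp add: wrank_def filter_insert_at) (simp add: insert_at_def)

text \<open>The rank of an old position grows by one exactly when the new letter precedes it, that
  is, when its rank was at least \<open>wrank w a i\<close>. So positions are shifted at
  \<open>i\<close> and ranks at \<open>wrank w a i\<close>.\<close>

lemma wrank_insert_at_shift:
  assumes i: "i \<le> length w" and j: "j < length w"
  shows "wrank (insert_at i a w) (w ! j) (shift i j) = shift (wrank w a i) (wrank w (w ! j) j)"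
proof -
  let ?b = "w ! j"
  have eq: "wrank (insert_at i a w) ?b (shift i j) = wrank w ?b j + of_bool (?b < a \<or> a = ?b \<and> i \<le> j)"
    using i by (auto simp: wrank_def filter_insert_at count_take_insert_at)
  have "wrank w ?b j < wrank w a i \<longleftrightarrow> \<not> (?b < a \<or> a = ?b \<and> i \<le> j)"
  proof
    assume *: "wrank w ?b j < wrank w a i"
    show "\<not> (?b < a \<or> a = ?b \<and> i \<le> j)"
      using * wrank_antimono_letter[of ?b a w i j] wrank_mono[of i j w a] by auto
  next
    assume "\<not> (?b < a \<or> a = ?b \<and> i \<le> j)"
    then show "wrank w ?b j < wrank w a i" using j by (intro wrank_less) auto
  qed
  then show ?thesis using eq by (simp add: shift_def)
qed

lemma lessThan_Suc_shift: "p \<le> n \<Longrightarrow> {..<Suc n} = insert p (shift p ` {..<n})"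
proof -
  assume p: "p \<le> n"
  have "i \<in> shift p ` {..<n}" if "i < Suc n" "i \<noteq> p" for i
  proof (cases "i < p")
    case True then show ?thesis using p by (intro image_eqI[of _ _ i]) (auto simp: shift_def)
  next
    case False then show ?thesis using that by (intro image_eqI[of _ _ "i - 1"]) (auto simp: shift_def)
  qed
  moreover have "p < Suc n" "shift p i < Suc n" if "i < n" for i
    using p that by (auto simp: shift_def)
  ultimately show ?thesis using p by fastforce
qed

lemma shift_eq_iff: "shift p i = shift p j \<longleftrightarrow> i = j" and shift_neq: "shift p i \<noteq> p"
  by (auto simp: shift_def split: if_splits)

text \<open>Positions and ranks are now shifted at the same index \<open>i\<close>. As
  \<open>shift i\<close> is injective, it carries the old fixed points to the new ones other than
  \<open>i\<close>, and \<open>i\<close> itself is fixed.\<close>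

lemma fix_word_insert_at:
  assumes i: "i \<le> length w" and f: "wrank w a i = i"
  shows "fix_word (insert_at i a w) = Suc (fix_word w)"
proof -
  let ?F = "{j. j < length w \<and> wrank w (w ! j) j = j}"
  have "{k. k < length (insert_at i a w) \<and> wrank (insert_at i a w) (insert_at i a w ! k) k = k}
      = {k \<in> {..<Suc (length w)}. wrank (insert_at i a w) (insert_at i a w ! k) k = k}"
    using i by (auto simp: length_insert_at)
  also have "\<dots> = insert i (shift i ` ?F)"
    unfolding lessThan_Suc_shift[OF i]
    using i f by (auto simp: nth_insert_at nth_insert_at_shift wrank_insert_at wrank_insert_at_shift shift_eq_iff)
  finally have "fix_word (insert_at i a w) = card (insert i (shift i ` ?F))" by (simp add: fix_word_def)
  also have "\<dots> = Suc (card (shift i ` ?F))"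
    using shift_neq[of i] by (subst card_insert_disjoint) (auto, metis)
  also have "card (shift i ` ?F) = fix_word w"
    unfolding fix_word_def by (rule card_image) (simp add: inj_on_def shift_eq_iff)
  finally show ?thesis .
qed

text \<open>The integer \<open>i - f i\<close> starts at or below 0 and climbs by 0 or 1 at each
  step. Its zeros therefore form an interval, which is nonempty iff \<open>f N \<le> N\<close>, and
  a nonempty interval has one more point than pairs of consecutive points.\<close>

lemma card_fixed_points_unit_steps:
  fixes f :: "nat \<Rightarrow> nat"
  assumes "\<And>i. i < N \<Longrightarrow> f i \<le> f (Suc i) \<and> f (Suc i) \<le> Suc (f i)"
  shows "card {i. i \<le> N \<and> f i = i} = card {i. i < N \<and> f i = i \<and> f (Suc i) = Suc i} + of_bool (f N \<le> N)"
  using assms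
proof (induction N)
  case 0
  have "{i. i \<le> 0 \<and> f i = i} = (if f 0 = 0 then {0} else {})" by auto
  then show ?case by simp
next
  case (Suc N)
  have 1: "{i. i \<le> Suc N \<and> f i = i} = {i. i \<le> N \<and> f i = i} \<union> (if f (Suc N) = Suc N then {Suc N} else {})"
    by (auto simp: le_Suc_eq)
  have 2: "{i. i < Suc N \<and> f i = i \<and> f (Suc i) = Suc i}
      = {i. i < N \<and> f i = i \<and> f (Suc i) = Suc i} \<union> (if f N = N \<and> f (Suc N) = Suc N then {N} else {})"
    by (auto simp: less_Suc_eq)
  have "card {i. i \<le> N \<and> f i = i} = card {i. i < N \<and> f i = i \<and> f (Suc i) = Suc i} + of_bool (f N \<le> N)"
    using Suc by simp
  moreover have "f N \<le> f (Suc N) \<and> f (Suc N) \<le> Suc (f N)" using Suc.prems by simp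
  ultimately show ?case unfolding 1 2 by auto
qed

text \<open>Inserting \<open>a\<close> at gap \<open>i\<close> creates a fixed point iff \<open>wrank w a i = i\<close>. Such gaps form an interval,
  and two consecutive ones enclose an existing fixed point with letter \<open>a\<close>. The case of 2-cycles is
  the same with the composition of two rank maps.\<close>

lemma card_fixed_gaps:
  "card {i. i \<le> length w \<and> wrank w a i = i} = Suc (fix_letter w a)"
proof -
  have "card {i. i \<le> length w \<and> wrank w a i = i}
      = card {i. i < length w \<and> wrank w a i = i \<and> wrank w a (Suc i) = Suc i} + of_bool (wrank w a (length w) \<le> length w)"
    by (rule card_fixed_points_unit_steps) (simp add: wrank_Suc)
  also have "{i. i < length w \<and> wrank w a i = i \<and> wrank w a (Suc i) = Suc i}
     = {i. i < length w \<and> w ! i = a \<and> wrank w a i = i}"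
    by (auto simp: wrank_Suc of_bool_def split: if_splits)
  finally show ?thesis by (simp add: fix_letter_def wrank_le_length)
qed

lemma card_swapped_gaps:
  "card {i. i \<le> length w \<and> wrank w b (wrank w a i) = i} = Suc (swap_letters w a b)"
proof -
  \<comment> \<open>The inner rank moves by at most one, so the composition again has steps 0 or 1.
    It moves exactly when \<open>i\<close> carries \<open>a\<close> and the position named by its
    rank carries \<open>b\<close>.\<close>
  have step: "wrank w b (wrank w a (Suc i)) = wrank w b (wrank w a i)
      + of_bool (w ! i = a \<and> wrank w a i < length w \<and> w ! wrank w a i = b)" if "i < length w" for i
  proof (cases "w ! i = a")
    case True
    then have "wrank w a i < length w" using wrank_less_length that by blast
    then show ?thesis using that by (simp add: wrank_Suc)
  qed (use that in \<open>simp add: wrank_Suc\<close>)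
  have "card {i. i \<le> length w \<and> wrank w b (wrank w a i) = i}
      = card {i. i < length w \<and> wrank w b (wrank w a i) = i \<and> wrank w b (wrank w a (Suc i)) = Suc i}
        + of_bool (wrank w b (wrank w a (length w)) \<le> length w)"
    by (rule card_fixed_points_unit_steps) (simp add: step)
  also have "{i. i < length w \<and> wrank w b (wrank w a i) = i \<and> wrank w b (wrank w a (Suc i)) = Suc i}
     = {i. i < length w \<and> w ! i = a \<and> wrank w a i < length w \<and>
     w ! wrank w a i = b \<and> wrank w b (wrank w a i) = i}"
    by (intro Collect_cong, use step in \<open>auto simp: of_bool_def simp del: One_nat_def split: if_splits\<close>)
  finally show ?thesis by (simp add: swap_letters_def wrank_le_length)
qed

section \<open>The law of the sorting permutation\<close>

text \<open>Positions to ranks, with both indices moved from base 0 to base 1; it is the identity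
  elsewhere, as \<open>permutes\<close> demands.\<close>

definition rank_perm :: "'a::linorder list \<Rightarrow> nat \<Rightarrow> nat" where
  "rank_perm w j = (if j \<in> {1..length w} then Suc (wrank w (w ! (j - 1)) (j - 1)) else j)"

lemma rank_perm_less_iff:
  assumes "i \<in> {1..length w}" "j \<in> {1..length w}" "i \<noteq> j"
  shows "rank_perm w i < rank_perm w j
    \<longleftrightarrow> w ! (j - 1) < w ! (i - 1) \<or> w ! (j - 1) = w ! (i - 1) \<and> i < j"
proof -
  have less: "rank_perm w i < rank_perm w j"
    if "i \<in> {1..length w}" "j \<in> {1..length w}"
      "w ! (j - 1) < w ! (i - 1) \<or> w ! (j - 1) = w ! (i - 1) \<and> i < j" for i j
  proof -
    have "wrank w (w ! (i - 1)) (i - 1) < wrank w (w ! (j - 1)) (j - 1)"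
      using that by (intro wrank_less) auto
    then show ?thesis using that by (simp add: rank_perm_def)
  qed
  show ?thesis
  proof
    assume "rank_perm w i < rank_perm w j"
    then have "\<not> (w ! (i - 1) < w ! (j - 1) \<or> w ! (i - 1) = w ! (j - 1) \<and> j < i)"
      using less[OF assms(2,1)] by (meson less_asym)
    then show "w ! (j - 1) < w ! (i - 1) \<or> w ! (j - 1) = w ! (i - 1) \<and> i < j"
      using assms(3) by (meson linorder_neqE)
  qed (rule less[OF assms(1,2)])
qed

lemma rank_perm_permutes: "rank_perm w permutes {1..length w}"
proof (rule bij_imp_permutes)
  have "inj_on (rank_perm w) {1..length w}"
  proof (rule inj_onI, rule ccontr)
    fix i j assume *: "i \<in> {1..length w}" "j \<in> {1..length w}" "rank_perm w i = rank_perm w j" "i \<noteq> j"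
    then have "\<not> rank_perm w i < rank_perm w j" "\<not> rank_perm w j < rank_perm w i" by simp_all
    then show False using *(4) unfolding rank_perm_less_iff[OF *(1,2,4)] rank_perm_less_iff[OF *(2,1) *(4)[symmetric]]
      by (meson linorder_neqE)
  qed
  moreover have "rank_perm w ` {1..length w} \<subseteq> {1..length w}"
    using wrank_less_length[of _ w] by (auto simp: rank_perm_def Suc_le_eq)
  ultimately show "bij_betw (rank_perm w) {1..length w} {1..length w}"
    by (simp add: bij_betw_def endo_inj_surj)
qed (auto simp: rank_perm_def)

text \<open>Strict growth from a value at least 1 gives \<open>i \<le> f i\<close>; strict growth
  from \<open>i\<close> up to \<open>f n \<le> n\<close> gives \<open>f i \<le> i\<close>.\<close>

lemma strict_mono_endo_eq:
  fixes f :: "nat \<Rightarrow> nat"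
  assumes step: "\<And>i. i \<in> {1..<n} \<Longrightarrow> f i < f (Suc i)"
    and range: "f ` {1..n} \<subseteq> {1..n}" and i: "i \<in> {1..n}"
  shows "f i = i"
proof (rule antisym)
  have "i \<in> {1..n} \<Longrightarrow> i \<le> f i"
  proof (induction i)
    case (Suc i)
    show ?case
    proof (cases "i = 0")
      case True
      have "f (Suc i) \<in> {1..n}" by (intro subsetD[OF range] imageI Suc.prems)
      then show ?thesis using True by simp
    next
      case False
      then have "i \<le> f i" "f i < f (Suc i)" using Suc step[of i] by simp_all
      then show ?thesis by simp
    qed
  qed simp
  then show "i \<le> f i" using i by blast
  have "i + k \<le> n \<Longrightarrow> f i + k \<le> f (i + k)" for k
  proof (induction k)
    case (Suc k)
    then have "f i + k \<le> f (i + k)" "f (i + k) < f (Suc (i + k))" using i step[of "i + k"] by simp_all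
    then show ?case by simp
  qed simp
  from this[of "n - i"] have "f i + (n - i) \<le> f n" using i by simp
  moreover have "f n \<in> {1..n}" using i by (intro subsetD[OF range imageI]) simp
  ultimately show "f i \<le> i" using i unfolding atLeastAtMost_iff by linarith
qed

text \<open>The equality holds iff the positions \<open>\<pi> 1, ..., \<pi> n\<close> are listed in
  sorting order: letters decrease weakly, and strictly at each descent of \<open>\<pi>\<close>,
  since equal letters are listed from left to right. Conversely, such a listing makes
  \<open>rank_perm w \<circ> \<pi>\<close> an increasing self-map of \<open>{1..n}\<close>, hence
  the identity.\<close>

lemma inv_rank_perm_eq_iff:
  fixes w :: "nat list"
  assumes p: "\<pi> permutes {1..n}" and w: "length w = n"
  shows "inv (rank_perm w) = \<pi> \<longleftrightarrow>
    (\<forall>i\<in>{1..<n}. w ! (\<pi> (i + 1) - 1) + of_bool (\<pi> i > \<pi> (i + 1)) \<le> w ! (\<pi> i - 1))"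
    (is "_ \<longleftrightarrow> ?R")
proof -
  have W: "rank_perm w permutes {1..n}" using rank_perm_permutes w by blast
  have r: "\<pi> i \<in> {1..n}" "\<pi> (i + 1) \<in> {1..n}" "\<pi> i \<noteq> \<pi> (i + 1)" if "i \<in> {1..<n}" for i
  proof -
    show "\<pi> i \<in> {1..n}" "\<pi> (i + 1) \<in> {1..n}" using that by (auto simp only: permutes_in_image[OF p]) auto
    show "\<pi> i \<noteq> \<pi> (i + 1)" using permutes_inj[OF p] by (simp add: inj_eq)
  qed
  have R: "?R \<longleftrightarrow> (\<forall>i\<in>{1..<n}. rank_perm w (\<pi> i) < rank_perm w (\<pi> (i + 1)))"
  proof (rule ball_cong[OF refl])
    fix i assume "i \<in> {1..<n}"
    from r[OF this] show "w ! (\<pi> (i + 1) - 1) + of_bool (\<pi> i > \<pi> (i + 1)) \<le> w ! (\<pi> i - 1) \<longleftrightarrow>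
        rank_perm w (\<pi> i) < rank_perm w (\<pi> (i + 1))"
      by (subst rank_perm_less_iff) (auto simp: w)
  qed
  show ?thesis
  proof
    assume "inv (rank_perm w) = \<pi>"
    then have "rank_perm w (\<pi> i) = i" for i using permutes_inverses(1)[OF W] by metis
    then show ?R unfolding R by simp
  next
    assume ?R
    then have step: "\<And>i. i \<in> {1..<n} \<Longrightarrow> (rank_perm w \<circ> \<pi>) i < (rank_perm w \<circ> \<pi>) (Suc i)"
      unfolding R by simp
    have perm: "rank_perm w \<circ> \<pi> permutes {1..n}" using p W by (rule permutes_compose)
    have "(rank_perm w \<circ> \<pi>) i = i" for i
    proof (cases "i \<in> {1..n}")
      case True
      then show ?thesis using strict_mono_endo_eq[where f = "rank_perm w \<circ> \<pi>", OF step] permutes_image[OF perm] by blast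
    qed (use perm in \<open>auto simp: permutes_def\<close>)
    then have "inv (rank_perm w) i = \<pi> i" for i
      using permutes_inverses(2)[OF W] by (metis comp_apply)
    then show "inv (rank_perm w) = \<pi>" by blast
  qed
qed

text \<open>The letters of \<open>xs\<close> are listed in increasing order; the last one is compared first, so
  that the descent index separating a letter from the rest is the length of the rest.\<close>

fun chain :: "(nat \<Rightarrow> bool) \<Rightarrow> nat \<Rightarrow> nat list \<Rightarrow> bool" where
  "chain D m [] = True"
| "chain D m (x # xs) = (m \<le> x \<and> chain D (x + of_bool (D (length xs))) xs)"

lemma chain_map_rev_upt:
  "chain D m (map g (rev [1..<Suc k]))
    \<longleftrightarrow> (k > 0 \<longrightarrow> m \<le> g k) \<and> (\<forall>i\<in>{1..<k}. g (i + 1) + of_bool (D i) \<le> g i)"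
proof (induction k arbitrary: m)
  case (Suc k)
  have ball: "(\<forall>i\<in>{1..<Suc k}. Q i) \<longleftrightarrow> (k > 0 \<longrightarrow> Q k) \<and> (\<forall>i\<in>{1..<k}. Q i)" for Q
    by (auto simp: less_Suc_eq)
  have "chain D m (map g (rev [1..<Suc (Suc k)]))
      \<longleftrightarrow> m \<le> g (Suc k) \<and> chain D (g (Suc k) + of_bool (D k)) (map g (rev [1..<Suc k]))"
    by (subst upt_Suc) (simp del: upt_Suc)
  then show ?case unfolding Suc.IH ball by auto
qed simp

section \<open>The law of independent geometric letters\<close>

lemma q_int_eq: "q \<noteq> 1 \<Longrightarrow> q_int q n = (1 - q ^ n) / (1 - q)"
  by (simp add: q_int_def sum_gp_strict)

lemma nn_integral_geometric_pmf:
  assumes "0 < p" "p \<le> 1"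
  shows "(\<integral>\<^sup>+x. f x \<partial>geometric_pmf p) = (\<Sum>x. ennreal ((1 - p) ^ x * p) * f x)"
  using assms by (simp add: nn_integral_measure_pmf nn_integral_count_space_nat)

text \<open>Induction on the length, summing over the first and smallest letter
  \<open>x \<ge> m\<close>. The other \<open>n\<close> letters contribute
  \<open>q ^ (n * (x + d))\<close>, where \<open>d\<close> is 1 if \<open>D n\<close> holds and 0
  otherwise. Hence the series in \<open>x\<close> has ratio \<open>q ^ Suc n\<close> and produces
  the factor \<open>1 / q_int q (Suc n)\<close>, while \<open>n * d\<close> adds the descent index
  \<open>n\<close> to the exponent. The lower bound \<open>m\<close> is free so that the induction
  applies to the tail.\<close>

lemma nn_integral_chain:
  assumes q: "0 < q" "q < 1"
  shows "(\<integral>\<^sup>+xs. of_bool (chain D m xs) \<partial>replicate_pmf n (geometric_pmf (1 - q)))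
    = ennreal (q ^ (n * m) * q ^ (\<Sum>i | i \<in> {1..<n} \<and> D i. i) / q_fact q n)"
proof (induction n arbitrary: m)
  case 0
  then show ?case by (simp add: q_fact_def)
next
  case (Suc n)
  let ?W = "replicate_pmf n (geometric_pmf (1 - q))"
  let ?d = "of_bool (D n) :: nat" and ?s = "\<Sum>i | i \<in> {1..<n} \<and> D i. i"
  let ?f = "\<lambda>x. of_bool (m \<le> x) * (q ^ x * (1 - q) * (q ^ (n * (x + ?d)) * q ^ ?s / q_fact q n))"
  have qf: "q_fact q n > 0" using q_fact_pos q by blast
  have "{i. i \<in> {1..<Suc n} \<and> D i} = {i. i \<in> {1..<n} \<and> D i} \<union> (if n > 0 \<and> D n then {n} else {})"
    by (auto simp: less_Suc_eq)
  then have s: "(\<Sum>i | i \<in> {1..<Suc n} \<and> D i. i) = ?s + n * ?d" by auto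
  have "(\<lambda>x. (q ^ (Suc n * m) * q ^ (n * ?d) * q ^ ?s / q_fact q n) * (1 - q) * (q ^ Suc n) ^ x)
      sums ((q ^ (Suc n * m) * q ^ (n * ?d) * q ^ ?s / q_fact q n) * (1 - q) * (1 / (1 - q ^ Suc n)))"
    using q by (intro sums_mult geometric_sums) (auto simp: power_Suc_less_one simp del: power_Suc)
  moreover have "(\<lambda>x. (q ^ (Suc n * m) * q ^ (n * ?d) * q ^ ?s / q_fact q n) * (1 - q) * (q ^ Suc n) ^ x)
      = (\<lambda>x. ?f (x + m))"
  proof
    fix x
    have "q ^ (Suc n * m) * q ^ (n * ?d) * (q ^ Suc n) ^ x = q ^ (x + m) * q ^ (n * (x + m + ?d))"
      by (simp only: power_mult[symmetric] power_add[symmetric]) (simp add: algebra_simps)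
    moreover have "(A * B * S / F) * c * Z = U * c * (V * S / F)"
      if "A * B * Z = U * V" for A B S F c Z U V :: real
    proof -
      have "(A * B * S / F) * c * Z = (A * B * Z) * (c * S / F)" by simp
      then show ?thesis unfolding that by simp
    qed
    ultimately show "(q ^ (Suc n * m) * q ^ (n * ?d) * q ^ ?s / q_fact q n) * (1 - q) * (q ^ Suc n) ^ x = ?f (x + m)"
      by (simp only: le_add2 of_bool_eq mult_1)
  qed
  moreover have "(q ^ (Suc n * m) * q ^ (n * ?d) * q ^ ?s / q_fact q n) * (1 - q) * (1 / (1 - q ^ Suc n))
      = q ^ (Suc n * m) * q ^ (\<Sum>i | i \<in> {1..<Suc n} \<and> D i. i) / q_fact q (Suc n)"
  proof -
    have "q_fact q (Suc n) = q_fact q n * ((1 - q ^ Suc n) / (1 - q))"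
      using q by (simp add: q_fact_def q_int_eq)
    moreover have "(A * B * S / F) * c * (1 / z) = A * (S * B) / (F * (z / c))" for A B S F c z :: real
      by simp
    ultimately show ?thesis by (simp only: s power_add)
  qed
  \<comment> \<open>The terms with \<open>x < m\<close> vanish, so moving the index by
    \<open>m\<close> leaves the sum unchanged.\<close>
  ultimately have sums: "?f sums (q ^ (Suc n * m) * q ^ (\<Sum>i | i \<in> {1..<Suc n} \<and> D i. i) / q_fact q (Suc n))"
    by (subst sums_zero_iff_shift[symmetric, of m]) auto
  have len: "AE xs in ?W. length xs = n"
    by (simp add: AE_measure_pmf_iff set_replicate_pmf)
  have "(\<integral>\<^sup>+xs. of_bool (chain D m xs) \<partial>replicate_pmf (Suc n) (geometric_pmf (1 - q)))
    = (\<integral>\<^sup>+x. \<integral>\<^sup>+xs. of_bool (m \<le> x \<and> chain D (x + of_bool (D (length xs))) xs) \<partial>?W \<partial>geometric_pmf (1 - q))"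
    by simp
  also have "\<dots> = (\<integral>\<^sup>+x. of_bool (m \<le> x) * (\<integral>\<^sup>+xs. of_bool (chain D (x + ?d) xs) \<partial>?W) \<partial>geometric_pmf (1 - q))"
    by (subst nn_integral_cmult[symmetric], simp, intro nn_integral_cong nn_integral_cong_AE)
       (use len in \<open>auto elim!: eventually_mono\<close>)
  also have "\<dots> = (\<Sum>x. ennreal (?f x))"
  proof -
    have "ennreal ((1 - (1 - q)) ^ x * (1 - q)) * (of_bool (m \<le> x) * (\<integral>\<^sup>+xs. of_bool (chain D (x + ?d) xs) \<partial>?W))
        = ennreal (?f x)" for x
      using q qf by (cases "m \<le> x") (simp_all only: Suc.IH, simp_all add: ennreal_mult[symmetric] less_imp_le)
    moreover have "0 < 1 - q" "1 - q \<le> 1" using q by simp_all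
    ultimately show ?thesis by (simp only: nn_integral_geometric_pmf)
  qed
  also have "\<dots> = ennreal (q ^ (Suc n * m) * q ^ (\<Sum>i | i \<in> {1..<Suc n} \<and> D i. i) / q_fact q (Suc n))"
    using q qf by (intro suminf_ennreal_eq sums) auto
  finally show ?case .
qed

text \<open>Written as a product over the multiset of letters, the probability is visibly invariant
  under rearrangement.\<close>

lemma pmf_replicate_pmf:
  "pmf (replicate_pmf n p) w = of_bool (length w = n) * (\<Prod>x\<in>#mset w. pmf p x)"
proof (induction n arbitrary: w)
  case (Suc n)
  have eq: "replicate_pmf (Suc n) p = map_pmf (\<lambda>(x, xs). x # xs) (pair_pmf p (replicate_pmf n p))"
    by (simp add: pair_pmf_def map_pmf_def bind_assoc_pmf bind_return_pmf)
  show ?case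
  proof (cases w)
    case Nil
    then show ?thesis by (simp add: pmf_eq_0_set_pmf set_replicate_pmf del: replicate_pmf.simps)
  next
    case (Cons x xs)
    have "pmf (replicate_pmf (Suc n) p) w = pmf (pair_pmf p (replicate_pmf n p)) (x, xs)"
      unfolding eq Cons by (rule pmf_map_inj'[of "\<lambda>(x, xs). x # xs" _ "(x, xs)", simplified]) (auto simp: inj_def)
    then show ?thesis by (simp add: pmf_pair Suc Cons)
  qed
qed (auto simp: indicator_def)

text \<open>Independent identically distributed letters are exchangeable: the rearrangement is a
  bijection on words of length \<open>n\<close> and preserves the multiset of letters.\<close>

lemma map_pmf_replicate_pmf_permute:
  assumes p: "\<pi> permutes {1..n}"
  shows "map_pmf (\<lambda>w. map (\<lambda>i. w ! (\<pi> i - 1)) (rev [1..<Suc n])) (replicate_pmf n p) = replicate_pmf n p"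
    (is "map_pmf ?T ?W = ?W")
proof (rule pmf_eqI)
  fix y
  \<comment> \<open>The inverse rearrangement: \<open>?T\<close> moves the letter of position
    \<open>\<pi> k\<close> to index \<open>n - k\<close>, so the letter of position \<open>j\<close>
    is found at index \<open>n - inv \<pi> j\<close>.\<close>
  let ?T' = "\<lambda>w. map (\<lambda>j. w ! (n - inv \<pi> j)) [1..<Suc n]"
  have range: "\<pi> i \<in> {1..n}" "inv \<pi> i \<in> {1..n}" if "i \<in> {1..n}" for i
    using that permutes_in_image[OF p] permutes_in_image[OF permutes_inv[OF p]] by auto
  have T: "?T w ! (n - k) = w ! (\<pi> k - 1)" if "k \<in> {1..n}" for w k
    using that by (simp add: rev_nth del: upt_Suc)
  have 1: "?T' (?T w) = w" if "length w = n" for w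
  proof (rule nth_equalityI)
    fix i assume "i < length (?T' (?T w))"
    then have "i < n" by (simp del: upt_Suc)
    then show "?T' (?T w) ! i = w ! i"
      using T[of "inv \<pi> (Suc i)" w] range(2)[of "Suc i"] permutes_inverses(1)[OF p]
      by (simp del: upt_Suc)
  qed (use that in simp)
  have 2: "?T (?T' w) = w" if "length w = n" for w
  proof (rule nth_equalityI)
    fix i assume "i < length (?T (?T' w))"
    then have i: "i < n" by (simp del: upt_Suc)
    then have "?T (?T' w) ! i = ?T' w ! (\<pi> (n - i) - 1)"
      using T[of "n - i" "?T' w"] by simp
    moreover obtain k where "k = \<pi> (n - i)" "k \<in> {1..n}" "inv \<pi> k = n - i"
      using i range(1)[of "n - i"] permutes_inverses(2)[OF p] by simp
    ultimately show "?T (?T' w) ! i = w ! i" using i by (auto simp del: upt_Suc)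
  qed (use that in simp)
  have mset: "mset (?T w) = mset w" if "length w = n" for w
  proof -
    have upt: "mset [1..<Suc n] = mset_set {1..n}"
      by (simp only: mset_upt atLeastLessThanSuc_atLeastAtMost)
    have "mset (?T w) = image_mset (\<lambda>i. w ! (i - 1)) (image_mset \<pi> (mset_set {1..n}))"
      by (simp only: mset_map mset_rev upt image_mset.compositionality o_def)
    also have "image_mset \<pi> (mset_set {1..n}) = mset_set {1..n}"
      using image_mset_mset_set[OF permutes_inj_on[OF p]] permutes_image[OF p] by metis
    also have "image_mset (\<lambda>i. w ! (i - 1)) (mset_set {1..n}) = mset (map (\<lambda>i. w ! (i - 1)) [1..<Suc n])"
      by (simp only: mset_map upt)
    also have "map (\<lambda>i. w ! (i - 1)) [1..<Suc n] = w"
      by (rule nth_equalityI) (use that in \<open>auto simp del: upt_Suc\<close>)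
    finally show ?thesis .
  qed
  show "pmf (map_pmf ?T ?W) y = pmf ?W y"
  proof (cases "length y = n")
    case True
    have "pmf (map_pmf ?T ?W) y = measure ?W (?T -` {y})" by (rule pmf_map)
    \<comment> \<open>The two sets need to agree only on words of length \<open>n\<close>, which
      carry all the mass.\<close>
    also have "\<dots> = measure ?W {?T' y}"
    proof (rule measure_pmf.finite_measure_eq_AE)
      have "w \<in> ?T -` {y} \<longleftrightarrow> w \<in> {?T' y}" if "length w = n" for w
      proof
        assume "w \<in> ?T -` {y}"
        then have "?T w = y" by (simp only: vimage_singleton_eq)
        with 1[OF that] show "w \<in> {?T' y}" by (simp only: singleton_iff)
      qed (use 2[OF True] in \<open>simp only: vimage_singleton_eq singleton_iff\<close>)
      then show "AE w in ?W. w \<in> ?T -` {y} \<longleftrightarrow> w \<in> {?T' y}"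
        by (simp add: AE_measure_pmf_iff set_replicate_pmf del: upt_Suc)
    qed simp_all
    also have "\<dots> = pmf ?W (?T' y)" by (rule measure_pmf_single)
    also have "\<dots> = pmf ?W (?T (?T' y))"
      using mset[of "?T' y"] by (simp add: pmf_replicate_pmf del: upt_Suc)
    finally show ?thesis using 2[OF True] by simp
  next
    case False
    then have "pmf (map_pmf ?T ?W) y = 0" "pmf ?W y = 0"
      unfolding pmf_eq_0_set_pmf by (auto simp: set_replicate_pmf simp del: upt_Suc)
    then show ?thesis by (simp only:)
  qed
qed

text \<open>The event that \<open>\<pi>\<close> arises says that the letters read at
  \<open>\<pi> n, ..., \<pi> 1\<close> form a \<open>chain\<close> for the descents of
  \<open>\<pi>\<close>. By exchangeability the order of reading does not affect its probability, so
  \<open>\<pi>\<close> enters only through its descents, that is, through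
  \<open>maj\<close>.\<close>

lemma map_pmf_inv_rank_perm:
  assumes q: "0 < q" "q < 1"
  shows "map_pmf (\<lambda>w. inv (rank_perm w)) (replicate_pmf n (geometric_pmf (1 - q))) = Maj n q"
    (is "map_pmf ?f ?W = _")
proof (rule pmf_eqI)
  fix \<pi>
  have len: "AE w in ?W. length w = n"
    by (simp add: AE_measure_pmf_iff set_replicate_pmf)
  show "pmf (map_pmf ?f ?W) \<pi> = pmf (Maj n q) \<pi>"
  proof (cases "\<pi> permutes {1..n}")
    case False
    have "\<pi> \<notin> set_pmf (map_pmf ?f ?W)"
      using False permutes_inv[OF rank_perm_permutes] by (auto simp: set_replicate_pmf)
    then show ?thesis using False q by (simp add: pmf_Maj pmf_eq_0_set_pmf)
  next
    case True
    let ?D = "\<lambda>i. \<pi> i > \<pi> (i + 1)"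
    let ?T = "\<lambda>w. map (\<lambda>i. w ! (\<pi> i - 1)) (rev [1..<Suc n])"
    have "ennreal (pmf (map_pmf ?f ?W) \<pi>) = (\<integral>\<^sup>+w. indicator (?f -` {\<pi>}) w \<partial>?W)"
      by (simp add: ennreal_pmf_map)
    also have "\<dots> = (\<integral>\<^sup>+w. of_bool (chain ?D 0 (?T w)) \<partial>?W)"
    proof (rule nn_integral_cong_AE, use len in eventually_elim)
      fix w :: "nat list" assume "length w = n"
      then have "inv (rank_perm w) = \<pi> \<longleftrightarrow> chain ?D 0 (?T w)"
        by (simp only: chain_map_rev_upt inv_rank_perm_eq_iff[OF True]) simp
      then show "indicator (?f -` {\<pi>}) w = (of_bool (chain ?D 0 (?T w)) :: ennreal)"
        by (simp add: indicator_def del: upt_Suc)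
    qed
    also have "\<dots> = (\<integral>\<^sup>+xs. of_bool (chain ?D 0 xs) \<partial>map_pmf ?T ?W)" by simp
    also have "\<dots> = ennreal (q ^ maj n \<pi> / q_fact q n)"
      unfolding map_pmf_replicate_pmf_permute[OF True] nn_integral_chain[OF q] by (simp add: maj_def)
    finally show ?thesis using True q q_fact_pos[of q n] by (simp add: pmf_Maj)
  qed
qed

section \<open>Deleting short cycles from a random word\<close>

text \<open>Fixing one letter of an independent word costs its probability and leaves an independent
  word one letter shorter.\<close>

lemma nn_integral_replicate_pmf_nth:
  "i \<le> n \<Longrightarrow> (\<integral>\<^sup>+w. of_bool (w ! i = a) * h w \<partial>replicate_pmf (Suc n) p)
    = ennreal (pmf p a) * (\<integral>\<^sup>+w. h (insert_at i a w) \<partial>replicate_pmf n p)"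
proof (induction i arbitrary: n h)
  case 0
  have "(\<integral>\<^sup>+w. of_bool (w ! 0 = a) * h w \<partial>replicate_pmf (Suc n) p)
      = (\<integral>\<^sup>+x. \<integral>\<^sup>+w. of_bool (x = a) * h (x # w) \<partial>replicate_pmf n p \<partial>p)"
    by simp
  also have "\<dots> = (\<integral>\<^sup>+x. (\<integral>\<^sup>+w. h (a # w) \<partial>replicate_pmf n p) * indicator {a} x \<partial>p)"
    by (intro nn_integral_cong) (simp add: indicator_def)
  also have "\<dots> = (\<integral>\<^sup>+w. h (a # w) \<partial>replicate_pmf n p) * emeasure p {a}"
    by (rule nn_integral_cmult_indicator) simp
  finally show ?case by (simp add: emeasure_pmf_single insert_at_def mult.commute)
next
  case (Suc i)
  then obtain m where n: "n = Suc m" "i \<le> m" by (cases n) auto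
  have "(\<integral>\<^sup>+w. of_bool (w ! Suc i = a) * h w \<partial>replicate_pmf (Suc n) p)
      = (\<integral>\<^sup>+x. \<integral>\<^sup>+w. of_bool (w ! i = a) * h (x # w) \<partial>replicate_pmf (Suc m) p \<partial>p)"
    unfolding n replicate_pmf.simps(2)[of "Suc m"] by (simp del: replicate_pmf.simps)
  also have "\<dots> = (\<integral>\<^sup>+x. ennreal (pmf p a) * (\<integral>\<^sup>+w. h (x # insert_at i a w) \<partial>replicate_pmf m p) \<partial>p)"
    by (simp only: Suc.IH[OF n(2)])
  also have "\<dots> = ennreal (pmf p a) * (\<integral>\<^sup>+w. h (insert_at (Suc i) a w) \<partial>replicate_pmf n p)"
    by (simp add: nn_integral_cmult n insert_at_def)
  finally show ?case .
qed

text \<open>Sum over the position \<open>i\<close> of the marked fixed point and delete it; the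
  admissible gaps are then counted by \<open>card_fixed_gaps\<close>. A constant \<open>g\<close>
  gives the first moment, the identity gives the mixed second moment.\<close>

lemma nn_integral_fix_letter_Suc:
  fixes g :: "nat \<Rightarrow> ennreal"
  shows "(\<integral>\<^sup>+w. of_nat (fix_letter w a) * g (fix_word w) \<partial>replicate_pmf (Suc n) p)
    = ennreal (pmf p a) * (\<integral>\<^sup>+w. of_nat (Suc (fix_letter w a)) * g (Suc (fix_word w)) \<partial>replicate_pmf n p)"
proof -
  have "(\<integral>\<^sup>+w. of_nat (fix_letter w a) * g (fix_word w) \<partial>replicate_pmf (Suc n) p)
      = (\<integral>\<^sup>+w. (\<Sum>i\<le>n. of_bool (w ! i = a) * (of_bool (wrank w a i = i) * g (fix_word w))) \<partial>replicate_pmf (Suc n) p)"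
  proof (rule nn_integral_cong_AE, unfold AE_measure_pmf_iff, rule ballI)
    fix w assume "w \<in> set_pmf (replicate_pmf (Suc n) p)"
    then have w: "length w = Suc n" by (simp add: set_replicate_pmf del: replicate_pmf.simps)
    have "{i. i < length w \<and> w ! i = a \<and> wrank w a i = i} = {..n} \<inter> {i. w ! i = a \<and> wrank w a i = i}"
      using w by auto
    then have "of_nat (fix_letter w a) = (\<Sum>i\<le>n. of_bool (w ! i = a \<and> wrank w a i = i) :: ennreal)"
      by (simp add: fix_letter_def sum_of_bool_eq)
    then show "of_nat (fix_letter w a) * g (fix_word w)
        = (\<Sum>i\<le>n. of_bool (w ! i = a) * (of_bool (wrank w a i = i) * g (fix_word w)))"
      by (simp add: sum_distrib_right of_bool_conj mult.assoc)
  qed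
  also have "\<dots> = (\<Sum>i\<le>n. \<integral>\<^sup>+w. of_bool (w ! i = a) * (of_bool (wrank w a i = i) * g (fix_word w)) \<partial>replicate_pmf (Suc n) p)"
    by (rule nn_integral_sum) simp
  also have "\<dots> = (\<Sum>i\<le>n. ennreal (pmf p a) *
      (\<integral>\<^sup>+w. of_bool (wrank (insert_at i a w) a i = i) * g (fix_word (insert_at i a w)) \<partial>replicate_pmf n p))"
    by (intro sum.cong refl nn_integral_replicate_pmf_nth) simp
  also have "\<dots> = ennreal (pmf p a) *
      (\<integral>\<^sup>+w. (\<Sum>i\<le>n. of_bool (wrank (insert_at i a w) a i = i) * g (fix_word (insert_at i a w))) \<partial>replicate_pmf n p)"
    by (subst nn_integral_sum, simp, rule sum_distrib_left[symmetric])
  also have "(\<integral>\<^sup>+w. (\<Sum>i\<le>n. of_bool (wrank (insert_at i a w) a i = i) * g (fix_word (insert_at i a w))) \<partial>replicate_pmf n p)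
      = (\<integral>\<^sup>+w. of_nat (Suc (fix_letter w a)) * g (Suc (fix_word w)) \<partial>replicate_pmf n p)"
  proof (rule nn_integral_cong_AE, unfold AE_measure_pmf_iff, rule ballI)
    fix w assume "w \<in> set_pmf (replicate_pmf n p)"
    then have w: "length w = n" by (simp add: set_replicate_pmf)
    have "(\<Sum>i\<le>n. of_bool (wrank (insert_at i a w) a i = i) * g (fix_word (insert_at i a w)))
        = (\<Sum>i\<le>n. of_bool (wrank w a i = i) * g (Suc (fix_word w)))"
      using w by (intro sum.cong refl) (auto simp: wrank_insert_at fix_word_insert_at)
    also have "\<dots> = of_nat (card ({..n} \<inter> {i. wrank w a i = i})) * g (Suc (fix_word w))"
      by (simp add: sum_of_bool_eq flip: sum_distrib_right)
    also have "{..n} \<inter> {i. wrank w a i = i} = {i. i \<le> length w \<and> wrank w a i = i}"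
      using w by auto
    finally show "(\<Sum>i\<le>n. of_bool (wrank (insert_at i a w) a i = i) * g (fix_word (insert_at i a w)))
      = of_nat (Suc (fix_letter w a)) * g (Suc (fix_word w))" by (simp only: card_fixed_gaps)
  qed
  finally show ?thesis .
qed

lemma nn_integral_sum_sum_pmf:
  "(\<integral>\<^sup>+w. (\<Sum>i\<in>A. \<Sum>j\<in>B i. f i j w) \<partial>measure_pmf M)
    = (\<Sum>i\<in>A. \<Sum>j\<in>B i. \<integral>\<^sup>+w. f i j w \<partial>measure_pmf M)"
  by (subst nn_integral_sum, simp, intro sum.cong refl, rule nn_integral_sum, simp)

lemma wrank_insert_at_before:
  assumes "i \<le> j" "j \<le> length w"
  shows "wrank (insert_at j b w) a i = wrank w a i + of_bool (a < b)"
proof -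
  have "take i (insert_at j b w) = take i w" using assms by (simp add: insert_at_def min_def)
  then show ?thesis by (simp add: wrank_def filter_insert_at)
qed

lemma nn_integral_swap_letters_Suc_Suc:
  fixes p :: "'a::linorder pmf"
  assumes ab: "a < b"
  shows "(\<integral>\<^sup>+w. of_nat (swap_letters w a b) \<partial>replicate_pmf (Suc (Suc n)) p)
    = ennreal (pmf p a) * (ennreal (pmf p b) * (\<integral>\<^sup>+w. of_nat (Suc (swap_letters w a b)) \<partial>replicate_pmf n p))"
    (is "?lhs = ?rhs")
proof -
  \<comment> \<open>As \<open>b > a\<close>, the partner of \<open>i\<close> has smaller rank than
    \<open>i\<close>; so \<open>i\<close>, being the partner's rank, is smaller than the partner's
    position. The partner is therefore \<open>Suc j\<close> with \<open>j \<ge> i\<close>, and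
    becomes \<open>j\<close> once \<open>i\<close> is deleted.\<close>
  have "?lhs = (\<integral>\<^sup>+w. (\<Sum>i\<le>Suc n. \<Sum>j\<in>{i..n}. of_bool (w ! i = a) *
      of_bool (w ! Suc j = b \<and> wrank w a i = Suc j \<and> wrank w b (Suc j) = i)) \<partial>replicate_pmf (Suc (Suc n)) p)"
  proof (rule nn_integral_cong_AE, unfold AE_measure_pmf_iff, rule ballI)
    fix w assume "w \<in> set_pmf (replicate_pmf (Suc (Suc n)) p)"
    then have w: "length w = Suc (Suc n)" by (simp add: set_replicate_pmf del: replicate_pmf.simps)
    let ?P = "\<lambda>i. w ! i = a \<and> wrank w a i < length w \<and> w ! wrank w a i = b \<and> wrank w b (wrank w a i) = i"
    have "of_nat (swap_letters w a b) = (\<Sum>i\<le>Suc n. of_bool (?P i) :: ennreal)"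
    proof -
      have "{i. i < length w \<and> ?P i} = {..Suc n} \<inter> {i. ?P i}" using w by auto
      then show ?thesis by (simp add: swap_letters_def sum_of_bool_eq del: sum.atMost_Suc)
    qed
    also have "\<dots> = (\<Sum>i\<le>Suc n. \<Sum>j\<in>{i..n}. of_bool (w ! i = a) *
        of_bool (w ! Suc j = b \<and> wrank w a i = Suc j \<and> wrank w b (Suc j) = i))"
    proof (intro sum.cong refl)
      fix i assume "i \<in> {..Suc n}"
      have "(\<Sum>j\<in>{i..n}. of_bool (w ! i = a) *
          of_bool (w ! Suc j = b \<and> wrank w a i = Suc j \<and> wrank w b (Suc j) = i))
        = (\<Sum>j\<in>{i..n}. if wrank w a i - 1 = j then of_bool (?P i) else 0 :: ennreal)"
      proof (intro sum.cong refl)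
        fix j assume j: "j \<in> {i..n}"
        \<comment> \<open>Positivity makes the truncated \<open>wrank w a i - 1\<close> a true
          predecessor.\<close>
        have "wrank w a i > 0" if "?P i"
          using wrank_less[of "wrank w a i" w a i] that ab by auto
        then show "of_bool (w ! i = a) * of_bool (w ! Suc j = b \<and> wrank w a i = Suc j \<and> wrank w b (Suc j) = i)
          = (if wrank w a i - 1 = j then of_bool (?P i) else 0 :: ennreal)"
        proof (cases "wrank w a i = Suc j")
          case True
          then show ?thesis using j w by (simp add: of_bool_conj)
        next
          case False
          then have "\<not> ?P i" if "wrank w a i - 1 = j"
            using \<open>?P i \<Longrightarrow> wrank w a i > 0\<close> that by linarith
          then show ?thesis using False by simp
        qed
      qed
      also have "\<dots> = of_bool (?P i \<and> wrank w a i - 1 \<in> {i..n})"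
        by (simp add: sum.delta')
      also have "?P i \<and> wrank w a i - 1 \<in> {i..n} \<longleftrightarrow> ?P i"
        using wrank_less[of "wrank w a i" w a i] w ab by auto
      finally show "of_bool (?P i) = (\<Sum>j\<in>{i..n}. of_bool (w ! i = a) *
          of_bool (w ! Suc j = b \<and> wrank w a i = Suc j \<and> wrank w b (Suc j) = i) :: ennreal)" by simp
    qed
    finally show "of_nat (swap_letters w a b) = (\<Sum>i\<le>Suc n. \<Sum>j\<in>{i..n}. of_bool (w ! i = a) *
        of_bool (w ! Suc j = b \<and> wrank w a i = Suc j \<and> wrank w b (Suc j) = i) :: ennreal)" .
  qed
  also have "\<dots> = (\<Sum>i\<le>Suc n. \<Sum>j\<in>{i..n}. \<integral>\<^sup>+w. of_bool (w ! i = a) *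
      of_bool (w ! Suc j = b \<and> wrank w a i = Suc j \<and> wrank w b (Suc j) = i) \<partial>replicate_pmf (Suc (Suc n)) p)"
    by (rule nn_integral_sum_sum_pmf)
  also have "\<dots> = (\<Sum>i\<le>Suc n. \<Sum>j\<in>{i..n}. ennreal (pmf p a) * (ennreal (pmf p b) *
      (\<integral>\<^sup>+w. of_bool (wrank w a i = j \<and> wrank w b j = i) \<partial>replicate_pmf n p)))"
  proof (intro sum.cong refl)
    fix i j assume "i \<in> {..Suc n}" "j \<in> {i..n}"
    then have ij: "i \<le> j" "j \<le> n" "i \<le> Suc n" by auto
    have "(\<integral>\<^sup>+w. of_bool (w ! i = a) *
        of_bool (w ! Suc j = b \<and> wrank w a i = Suc j \<and> wrank w b (Suc j) = i) \<partial>replicate_pmf (Suc (Suc n)) p)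
      = ennreal (pmf p a) * (\<integral>\<^sup>+w. of_bool (insert_at i a w ! Suc j = b \<and> wrank (insert_at i a w) a i = Suc j \<and>
          wrank (insert_at i a w) b (Suc j) = i) \<partial>replicate_pmf (Suc n) p)"
      by (rule nn_integral_replicate_pmf_nth) (rule ij)
    also have "(\<integral>\<^sup>+w. of_bool (insert_at i a w ! Suc j = b \<and> wrank (insert_at i a w) a i = Suc j \<and>
          wrank (insert_at i a w) b (Suc j) = i) \<partial>replicate_pmf (Suc n) p)
        = (\<integral>\<^sup>+w. of_bool (w ! j = b) * of_bool (wrank w a i = Suc j \<and> wrank w b j = i) \<partial>replicate_pmf (Suc n) p)"
    proof (rule nn_integral_cong_AE, unfold AE_measure_pmf_iff, rule ballI)
      fix w assume "w \<in> set_pmf (replicate_pmf (Suc n) p)"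
      then have w: "length w = Suc n" by (simp add: set_replicate_pmf del: replicate_pmf.simps)
      have s: "shift i j = Suc j" using ij by (simp add: shift_def)
      have "insert_at i a w ! Suc j = w ! j" using nth_insert_at_shift[of i w j a] s ij w by simp
      \<comment> \<open>A larger letter precedes \<open>a\<close> in the sorting order, so inserting
        \<open>a\<close> leaves its rank alone.\<close>
      moreover have "wrank (insert_at i a w) (w ! j) (Suc j) = wrank w (w ! j) j" if "w ! j = b"
        using wrank_insert_at_shift[of i w j a] wrank_less[of j w a i] s ij w that ab by (simp add: shift_def)
      ultimately show "of_bool (insert_at i a w ! Suc j = b \<and> wrank (insert_at i a w) a i = Suc j \<and>
          wrank (insert_at i a w) b (Suc j) = i)
        = (of_bool (w ! j = b) * of_bool (wrank w a i = Suc j \<and> wrank w b j = i) :: ennreal)"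
        using ij w by (auto simp: wrank_insert_at)
    qed
    also have "\<dots> = ennreal (pmf p b) * (\<integral>\<^sup>+w. of_bool (wrank (insert_at j b w) a i = Suc j \<and>
        wrank (insert_at j b w) b j = i) \<partial>replicate_pmf n p)"
      by (rule nn_integral_replicate_pmf_nth) (rule ij)
    \<comment> \<open>Deleting the larger letter \<open>b\<close> lowers the rank of
      \<open>a\<close> by one, from \<open>Suc j\<close> to \<open>j\<close>, and keeps the rank of
      \<open>b\<close> itself.\<close>
    also have "(\<integral>\<^sup>+w. of_bool (wrank (insert_at j b w) a i = Suc j \<and> wrank (insert_at j b w) b j = i) \<partial>replicate_pmf n p)
        = (\<integral>\<^sup>+w. of_bool (wrank w a i = j \<and> wrank w b j = i) \<partial>replicate_pmf n p)"
      by (intro nn_integral_cong_AE)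
        (use ij ab in \<open>auto simp: AE_measure_pmf_iff set_replicate_pmf wrank_insert_at wrank_insert_at_before\<close>)
    finally show "(\<integral>\<^sup>+w. of_bool (w ! i = a) *
        of_bool (w ! Suc j = b \<and> wrank w a i = Suc j \<and> wrank w b (Suc j) = i) \<partial>replicate_pmf (Suc (Suc n)) p)
      = ennreal (pmf p a) * (ennreal (pmf p b) *
      (\<integral>\<^sup>+w. of_bool (wrank w a i = j \<and> wrank w b j = i) \<partial>replicate_pmf n p))" .
  qed
  also have "\<dots> = ennreal (pmf p a) * (ennreal (pmf p b) *
      (\<integral>\<^sup>+w. (\<Sum>i\<le>Suc n. \<Sum>j\<in>{i..n}. of_bool (wrank w a i = j \<and> wrank w b j = i)) \<partial>replicate_pmf n p))"
    by (simp only: nn_integral_sum_sum_pmf sum_distrib_left)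
  also have "(\<integral>\<^sup>+w. (\<Sum>i\<le>Suc n. \<Sum>j\<in>{i..n}. of_bool (wrank w a i = j \<and> wrank w b j = i)) \<partial>replicate_pmf n p)
      = (\<integral>\<^sup>+w. of_nat (Suc (swap_letters w a b)) \<partial>replicate_pmf n p)"
  proof (rule nn_integral_cong_AE, unfold AE_measure_pmf_iff, rule ballI)
    fix w assume "w \<in> set_pmf (replicate_pmf n p)"
    then have w: "length w = n" by (simp add: set_replicate_pmf)
    have "(\<Sum>i\<le>Suc n. \<Sum>j\<in>{i..n}. of_bool (wrank w a i = j \<and> wrank w b j = i) :: ennreal)
      = (\<Sum>i\<le>Suc n. of_bool (i \<le> n \<and> wrank w b (wrank w a i) = i))"
    proof (intro sum.cong refl)
      fix i
      have "(\<Sum>j\<in>{i..n}. of_bool (wrank w a i = j \<and> wrank w b j = i) :: ennreal)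
        = (\<Sum>j\<in>{i..n}. if wrank w a i = j then of_bool (wrank w b (wrank w a i) = i) else 0)"
        by (intro sum.cong refl) auto
      also have "\<dots> = of_bool (wrank w a i \<in> {i..n} \<and> wrank w b (wrank w a i) = i)"
        by (auto simp: sum.delta')
      \<comment> \<open>The range for \<open>j\<close> imposes nothing further: the value
        \<open>i\<close> is a rank of \<open>b\<close>, hence at most the rank of \<open>a\<close>,
        which is at most \<open>n\<close>.\<close>
      also have "wrank w a i \<in> {i..n} \<and> wrank w b (wrank w a i) = i
          \<longleftrightarrow> i \<le> n \<and> wrank w b (wrank w a i) = i"
        using wrank_antimono_letter[OF ab, of w "wrank w a i" i] wrank_le_length[of w a i]
          wrank_le_length[of w b "wrank w a i"] w by auto
      finally show "(\<Sum>j\<in>{i..n}. of_bool (wrank w a i = j \<and> wrank w b j = i))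
        = (of_bool (i \<le> n \<and> wrank w b (wrank w a i) = i) :: ennreal)" .
    qed
    also have "\<dots> = of_nat (card {i. i \<le> length w \<and> wrank w b (wrank w a i) = i})"
    proof -
      have "{..Suc n} \<inter> {i. i \<le> n \<and> wrank w b (wrank w a i) = i}
          = {i. i \<le> length w \<and> wrank w b (wrank w a i) = i}" using w by auto
      then show ?thesis by (simp add: sum_of_bool_eq del: sum.atMost_Suc)
    qed
    finally show "(\<Sum>i\<le>Suc n. \<Sum>j\<in>{i..n}. of_bool (wrank w a i = j \<and> wrank w b j = i) :: ennreal)
      = of_nat (Suc (swap_letters w a b))" by (simp only: card_swapped_gaps)
  qed
  finally show ?thesis .
qed

section \<open>Summation over the letters\<close>

lemma suminf_card_fibres:
  fixes f :: "'a \<Rightarrow> nat"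
  assumes "finite S"
  shows "(\<Sum>a. of_nat (card {i \<in> S. f i = a}) :: ennreal) = of_nat (card S)"
proof -
  have "(\<Sum>a. of_nat (card {i \<in> S. f i = a}) :: ennreal) = (\<Sum>a\<in>f ` S. of_nat (card {i \<in> S. f i = a}))"
    using assms by (intro suminf_finite) (auto simp: card_eq_0_iff)
  also have "\<dots> = of_nat (\<Sum>a\<in>f ` S. \<Sum>i\<in>{i \<in> S. f i = a}. 1)" by simp
  also have "(\<Sum>a\<in>f ` S. \<Sum>i\<in>{i \<in> S. f i = a}. 1) = (\<Sum>i\<in>S. 1 :: nat)"
    using assms by (intro sum.group) auto
  finally show ?thesis by simp
qed

lemma suminf_fix_letter: "(\<Sum>a. of_nat (fix_letter w a) :: ennreal) = of_nat (fix_word w)"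
proof -
  let ?S = "{i. i < length w \<and> wrank w (w ! i) i = i}"
  have "{i. i < length w \<and> w ! i = a \<and> wrank w a i = i} = {i \<in> ?S. w ! i = a}" for a by auto
  then show ?thesis
    unfolding fix_letter_def fix_word_def using suminf_card_fibres[of ?S "\<lambda>i. w ! i"] by simp
qed

text \<open>Each 2-cycle is counted at its position with the smaller letter.\<close>

definition swap_word :: "'a::linorder list \<Rightarrow> nat" where
  "swap_word w = card {i. i < length w \<and> w ! i < w ! wrank w (w ! i) i \<and>
     wrank w (w ! wrank w (w ! i) i) (wrank w (w ! i) i) = i}"

text \<open>Pairs of letters \<open>a < b\<close> are parametrised by
  \<open>b = Suc (a + d)\<close>, which turns the sum over pairs into iterated series over the
  naturals.\<close>

lemma suminf_swap_letters: "(\<Sum>a. \<Sum>d. of_nat (swap_letters w a (Suc (a + d))) :: ennreal) = of_nat (swap_word w)"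
proof -
  let ?r = "\<lambda>i. wrank w (w ! i) i"
  let ?S = "{i. i < length w \<and> w ! i < w ! ?r i \<and> ?r (?r i) = i}"
  have fib: "{i. i < length w \<and> w ! i = a \<and> wrank w a i < length w \<and>
     w ! wrank w a i = Suc (a + d) \<and> wrank w (Suc (a + d)) (wrank w a i) = i}
    = {i \<in> {i \<in> ?S. w ! i = a}. w ! ?r i - Suc (w ! i) = d}" for a d
  proof -
    have "i < length w \<and> w ! i = a \<and> wrank w a i < length w \<and>
        w ! wrank w a i = Suc (a + d) \<and> wrank w (Suc (a + d)) (wrank w a i) = i
      \<longleftrightarrow> i < length w \<and> w ! i = a \<and> w ! ?r i = Suc (a + d) \<and> ?r (?r i) = i" for i
      using wrank_less_length[of i w] by auto
    moreover have "w ! ?r i = Suc (a + d) \<longleftrightarrow> w ! i < w ! ?r i \<and> w ! ?r i - Suc (w ! i) = d"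
      if "w ! i = a" for i
      unfolding that by auto
    ultimately show ?thesis by blast
  qed
  have "(\<Sum>d. of_nat (swap_letters w a (Suc (a + d))) :: ennreal) = of_nat (card {i \<in> ?S. w ! i = a})" for a
    unfolding swap_letters_def fib by (rule suminf_card_fibres) simp
  then show ?thesis
    unfolding swap_word_def using suminf_card_fibres[of ?S "\<lambda>i. w ! i"] by simp
qed

section \<open>Short cycles of the permutation read off from the word\<close>

lemma fixed_points_inv_rank_perm: "fixed_points (length w) (inv (rank_perm w)) = fix_word w"
proof -
  have eq: "inv (rank_perm w) i = i \<longleftrightarrow> rank_perm w i = i" for i
    using permutes_inverses[OF rank_perm_permutes, of w] by metis
  have "{i \<in> {1..length w}. inv (rank_perm w) i = i} = Suc ` {i. i < length w \<and> wrank w (w ! i) i = i}"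
    unfolding eq by (auto simp: rank_perm_def image_iff gr0_conv_Suc Suc_le_eq)
  then show ?thesis by (simp add: fixed_points_def fix_word_def card_image)
qed

lemma two_cycles_inv_rank_perm: "two_cycles (length w) (inv (rank_perm w)) = swap_word w"
proof -
  let ?r = "\<lambda>i. wrank w (w ! i) i" and ?\<pi> = "inv (rank_perm w)"
  let ?S = "{i. i < length w \<and> w ! i < w ! ?r i \<and> ?r (?r i) = i}"
  let ?f = "\<lambda>i. {Suc i, Suc (?r i)}"
  have inv: "?\<pi> i = j \<longleftrightarrow> rank_perm w j = i" for i j
    using permutes_inverses[OF rank_perm_permutes, of w] by metis
  have "{{i, j} | i j. i \<in> {1..length w} \<and> j \<in> {1..length w} \<and> i \<noteq> j \<and> ?\<pi> i = j \<and> ?\<pi> j = i} = ?f ` ?S"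
    (is "?T = _")
  proof (intro set_eqI iffI)
    fix X assume "X \<in> ?T"
    then obtain i j where X: "X = {i, j}" and ij: "i \<in> {1..length w}" "j \<in> {1..length w}" "i \<noteq> j"
      and cyc: "rank_perm w j = i" "rank_perm w i = j" unfolding inv by blast
    obtain k l where kl: "i = Suc k" "j = Suc l" using ij by (metis atLeastAtMost_iff not0_implies_Suc not_one_le_zero)
    then have r: "?r l = k" "?r k = l" "k < length w" "l < length w" "k \<noteq> l"
      using ij cyc by (auto simp: rank_perm_def)
    \<comment> \<open>Ranks increase along equal letters, whereas a 2-cycle reverses the order of
      its two positions. So the smaller letter singles out one representative.\<close>
    have "w ! k \<noteq> w ! l"
    proof
      assume e: "w ! k = w ! l"
      have "k < l \<or> l < k" using r(5) by auto
      then show False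
      proof
        assume "k < l"
        then show False using wrank_less[of k w "w ! l" l] e r by simp
      next
        assume "l < k"
        then show False using wrank_less[of l w "w ! k" k] e r by simp
      qed
    qed
    then consider "w ! k < w ! l" | "w ! l < w ! k" by (meson linorder_neqE)
    then show "X \<in> ?f ` ?S"
    proof cases
      case 1
      then show ?thesis using r by (intro image_eqI[of _ _ k]) (auto simp: X kl)
    next
      case 2
      then show ?thesis using r by (intro image_eqI[of _ _ l]) (auto simp: X kl)
    qed
  next
    fix X assume "X \<in> ?f ` ?S"
    then obtain i where i: "X = ?f i" "i < length w" "w ! i < w ! ?r i" "?r (?r i) = i" by blast
    moreover have "?r i < length w" using i(2) by (rule wrank_less_length)
    moreover have "i \<noteq> ?r i" using i(3) by (metis less_irrefl)
    ultimately show "X \<in> ?T" unfolding inv mem_Collect_eq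
      by (intro exI[of _ "Suc i"] exI[of _ "Suc (?r i)"]) (auto simp: rank_perm_def)
  qed
  moreover have "inj_on ?f ?S"
  proof (rule inj_onI)
    fix i k assume ik: "i \<in> ?S" "k \<in> ?S" "?f i = ?f k"
    then have "i = k \<or> i = ?r k \<and> k = ?r i" by (auto simp: doubleton_eq_iff)
    then show "i = k"
    proof
      assume *: "i = ?r k \<and> k = ?r i"
      then have r: "?r i = k" "?r k = i" by (rule conjunct2[THEN sym], rule conjunct1[THEN sym])
      have "w ! i < w ! k" using ik(1) unfolding mem_Collect_eq r by blast
      moreover have "w ! k < w ! i" using ik(2) unfolding mem_Collect_eq r by blast
      ultimately show ?thesis by simp
    qed
  qed
  ultimately show ?thesis by (simp add: two_cycles_def swap_word_def card_image)
qed

section \<open>Moments as polynomials in the letter probabilities\<close>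

lemma nn_integral_fix_letter:
  "(\<integral>\<^sup>+w. of_nat (fix_letter w a) \<partial>replicate_pmf n p) = ennreal (\<Sum>k<n. pmf p a ^ Suc k)"
proof (induction n)
  case 0
  then show ?case by (simp add: fix_letter_def)
next
  case (Suc n)
  \<comment> \<open>With constant \<open>g\<close> the deletion identity is the recursion
    \<open>e (n + 1) = x * (1 + e n)\<close>, solved by a geometric sum.\<close>
  have "(\<integral>\<^sup>+w. of_nat (fix_letter w a) \<partial>replicate_pmf (Suc n) p)
      = ennreal (pmf p a) * (\<integral>\<^sup>+w. 1 + of_nat (fix_letter w a) \<partial>replicate_pmf n p)"
    using nn_integral_fix_letter_Suc[where a = a and g = "\<lambda>_. 1" and n = n and p = p] by (simp del: replicate_pmf.simps)
  also have "(\<integral>\<^sup>+w. 1 + of_nat (fix_letter w a) \<partial>replicate_pmf n p) = ennreal (1 + (\<Sum>k<n. pmf p a ^ Suc k))"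
    by (subst nn_integral_add) (simp_all add: Suc sum_nonneg del: power_Suc)
  also have "ennreal (pmf p a) * \<dots> = ennreal (\<Sum>k<Suc n. pmf p a ^ Suc k)"
    by (subst ennreal_mult[symmetric])
      (simp_all add: sum_nonneg sum.lessThan_Suc_shift sum_distrib_left distrib_left del: sum.lessThan_Suc)
  finally show ?case .
qed

lemma nn_integral_swap_letters:
  fixes p :: "'a::linorder pmf"
  assumes ab: "a < b"
  shows "(\<integral>\<^sup>+w. of_nat (swap_letters w a b) \<partial>replicate_pmf n p) = ennreal (\<Sum>k<n div 2. (pmf p a * pmf p b) ^ Suc k)"
proof (induction n rule: induct_nat_012)
  case 0
  then show ?case by (simp add: swap_letters_def)
next
  case 1
  have "swap_letters [x] a b = 0" for x
    using ab by (auto simp: swap_letters_def wrank_def card_eq_0_iff split: if_splits)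
  then show ?case by simp
next
  case (ge2 n)
  let ?y = "pmf p a * pmf p b"
  have "(\<integral>\<^sup>+w. of_nat (swap_letters w a b) \<partial>replicate_pmf (Suc (Suc n)) p)
      = ennreal (pmf p a) * (ennreal (pmf p b) * (\<integral>\<^sup>+w. 1 + of_nat (swap_letters w a b) \<partial>replicate_pmf n p))"
    unfolding nn_integral_swap_letters_Suc_Suc[OF ab] by simp
  also have "(\<integral>\<^sup>+w. 1 + of_nat (swap_letters w a b) \<partial>replicate_pmf n p) = ennreal (1 + (\<Sum>k<n div 2. ?y ^ Suc k))"
    by (subst nn_integral_add) (simp_all add: ge2(1) sum_nonneg del: power_Suc)
  also have "ennreal (pmf p a) * (ennreal (pmf p b) * \<dots>) = ennreal (?y * (1 + (\<Sum>k<n div 2. ?y ^ Suc k)))"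
    by (simp add: ennreal_mult sum_nonneg mult.assoc del: power_Suc)
  also have "?y * (1 + (\<Sum>k<n div 2. ?y ^ Suc k)) = (\<Sum>k<Suc (Suc n) div 2. ?y ^ Suc k)"
    by (simp add: sum.lessThan_Suc_shift sum_distrib_left distrib_left del: sum.lessThan_Suc)
  finally show ?case .
qed

text \<open>The index is shifted: \<open>power_sum q k\<close> is the power sum of degree \<open>k + 1\<close> of the letter
  probabilities, as shown in \<open>pmf_geometric_sums\<close>.\<close>

definition power_sum :: "real \<Rightarrow> nat \<Rightarrow> real" where
  "power_sum q k = (1 - q) ^ k / q_int q (Suc k)"

definition mean_fix :: "real \<Rightarrow> nat \<Rightarrow> real" where
  "mean_fix q n = (\<Sum>k<n. power_sum q k)"

text \<open>The uncentred mixed moment of \<open>fix_letter w a\<close> and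
  \<open>fix_word w\<close> for words of length \<open>n\<close>, as a function of the probability
  \<open>x\<close> of \<open>a\<close>.\<close>

definition cov_fix :: "real \<Rightarrow> nat \<Rightarrow> real \<Rightarrow> real" where
  "cov_fix q n x = (\<Sum>k<n. real (Suc k) * x ^ Suc k) + (\<Sum>k<n. x ^ Suc k * mean_fix q (n - Suc k))"

lemma q_int_Suc_ge_1: "0 < q \<Longrightarrow> q_int q (Suc k) \<ge> 1"
  by (simp add: q_int_def sum.lessThan_Suc_shift sum_nonneg del: sum.lessThan_Suc)

lemma power_sum_nonneg: "0 < q \<Longrightarrow> q < 1 \<Longrightarrow> 0 \<le> power_sum q k"
  using q_int_Suc_ge_1[of q k] by (simp add: power_sum_def)

lemma power_sum_le: "0 < q \<Longrightarrow> q < 1 \<Longrightarrow> power_sum q k \<le> (1 - q) ^ k"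
  using q_int_Suc_ge_1[of q k] by (simp add: power_sum_def divide_le_eq mult_le_cancel_left1)

lemma mean_fix_nonneg: "0 < q \<Longrightarrow> q < 1 \<Longrightarrow> 0 \<le> mean_fix q n"
  by (simp add: mean_fix_def sum_nonneg power_sum_nonneg)

lemma cov_fix_Suc: "cov_fix q (Suc n) x = x * (1 + (\<Sum>k<n. x ^ Suc k) + mean_fix q n + cov_fix q n x)"
proof -
  have "(\<Sum>k<Suc n. real (Suc k) * x ^ Suc k) = x * (1 + (\<Sum>k<n. x ^ Suc k) + (\<Sum>k<n. real (Suc k) * x ^ Suc k))"
    unfolding sum.lessThan_Suc_shift
    by (simp add: sum_distrib_left algebra_simps sum.distrib)
  moreover have "(\<Sum>k<Suc n. x ^ Suc k * mean_fix q (Suc n - Suc k))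
      = x * (mean_fix q n + (\<Sum>k<n. x ^ Suc k * mean_fix q (n - Suc k)))"
    unfolding sum.lessThan_Suc_shift
    by (simp add: sum_distrib_left algebra_simps)
  ultimately show ?thesis by (simp add: cov_fix_def algebra_simps)
qed

lemma pmf_geometric_sums:
  assumes "0 < q" "q < 1"
  shows "(\<lambda>a. pmf (geometric_pmf (1 - q)) a ^ Suc k) sums power_sum q k"
proof -
  have "(\<lambda>a. (1 - q) ^ Suc k * (q ^ Suc k) ^ a) sums ((1 - q) ^ Suc k * (1 / (1 - q ^ Suc k)))"
    using assms by (intro sums_mult geometric_sums) (auto simp: power_Suc_less_one simp del: power_Suc)
  moreover have "(1 - q) ^ Suc k * (1 / (1 - q ^ Suc k)) = power_sum q k"
    using assms by (simp add: power_sum_def q_int_eq)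
  moreover have "(1 - q) ^ Suc k * (q ^ Suc k) ^ a = pmf (geometric_pmf (1 - q)) a ^ Suc k" for a
    using assms by (simp add: power_mult_distrib mult.commute del: power_Suc flip: power_mult)
  ultimately show ?thesis by simp
qed

lemma nn_integral_fix_word:
  assumes q: "0 < q" "q < 1"
  shows "(\<integral>\<^sup>+w. of_nat (fix_word w) \<partial>replicate_pmf n (geometric_pmf (1 - q))) = ennreal (mean_fix q n)"
proof -
  let ?G = "geometric_pmf (1 - q)"
  have "(\<integral>\<^sup>+w. of_nat (fix_word w) \<partial>replicate_pmf n ?G) = (\<Sum>a. \<integral>\<^sup>+w. of_nat (fix_letter w a) \<partial>replicate_pmf n ?G)"
    unfolding suminf_fix_letter[symmetric] by (rule nn_integral_suminf) simp
  also have "\<dots> = (\<Sum>a. ennreal (\<Sum>k<n. pmf ?G a ^ Suc k))" by (simp only: nn_integral_fix_letter)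
  also have "\<dots> = ennreal (mean_fix q n)"
    unfolding mean_fix_def
    by (intro suminf_ennreal_eq sums_sum pmf_geometric_sums q sum_nonneg) (simp del: power_Suc)
  finally show ?thesis .
qed

text \<open>For \<open>g\<close> the identity, deletion yields the product
  \<open>(1 + c_a) * (1 + c)\<close>; its four terms are those of the recursion
  \<open>cov_fix_Suc\<close>.\<close>

lemma nn_integral_fix_letter_fix_word:
  assumes q: "0 < q" "q < 1"
  shows "(\<integral>\<^sup>+w. of_nat (fix_letter w a) * of_nat (fix_word w) \<partial>replicate_pmf n (geometric_pmf (1 - q)))
    = ennreal (cov_fix q n (pmf (geometric_pmf (1 - q)) a))"
proof (induction n)
  case 0
  then show ?case by (simp add: fix_letter_def cov_fix_def)
next
  case (Suc n)
  let ?W = "replicate_pmf n (geometric_pmf (1 - q))" and ?x = "pmf (geometric_pmf (1 - q)) a"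
  have x: "0 \<le> ?x" by simp
  have nn: "0 \<le> cov_fix q n ?x"
    using q mean_fix_nonneg x unfolding cov_fix_def
    by (intro add_nonneg_nonneg sum_nonneg mult_nonneg_nonneg zero_le_power) simp_all
  have "(\<integral>\<^sup>+w. of_nat (fix_letter w a) * of_nat (fix_word w) \<partial>replicate_pmf (Suc n) (geometric_pmf (1 - q)))
      = ennreal ?x * (\<integral>\<^sup>+w. of_nat (Suc (fix_letter w a)) * of_nat (Suc (fix_word w)) \<partial>?W)"
    by (rule nn_integral_fix_letter_Suc)
  also have "(\<integral>\<^sup>+w. of_nat (Suc (fix_letter w a)) * of_nat (Suc (fix_word w)) \<partial>?W)
      = (\<integral>\<^sup>+w. 1 + of_nat (fix_letter w a) + of_nat (fix_word w) + of_nat (fix_letter w a) * of_nat (fix_word w) \<partial>?W)"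
    by (simp add: algebra_simps)
  also have "\<dots> = 1 + (\<integral>\<^sup>+w. of_nat (fix_letter w a) \<partial>?W) + (\<integral>\<^sup>+w. of_nat (fix_word w) \<partial>?W)
      + (\<integral>\<^sup>+w. of_nat (fix_letter w a) * of_nat (fix_word w) \<partial>?W)"
    by (simp add: nn_integral_add)
  also have "\<dots> = ennreal (1 + (\<Sum>k<n. ?x ^ Suc k) + mean_fix q n + cov_fix q n ?x)"
    unfolding nn_integral_fix_letter nn_integral_fix_word[OF q] Suc
    using nn mean_fix_nonneg[OF q, of n] sum_nonneg[of "{..<n}" "\<lambda>k. ?x ^ Suc k"] x
    by (simp del: power_Suc pmf_geometric)
  also have "ennreal ?x * \<dots> = ennreal (cov_fix q (Suc n) ?x)"
    unfolding cov_fix_Suc by (rule ennreal_mult'[symmetric]) (rule x)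
  finally show ?case .
qed

text \<open>Split one factor of the square by letters. Summing \<open>cov_fix\<close> over the
  letters replaces each power of a letter probability by the matching power sum.\<close>

lemma nn_integral_fix_word_square:
  assumes q: "0 < q" "q < 1"
  shows "(\<integral>\<^sup>+w. of_nat ((fix_word w)\<^sup>2) \<partial>replicate_pmf n (geometric_pmf (1 - q)))
    = ennreal ((\<Sum>k<n. real (Suc k) * power_sum q k) + (\<Sum>k<n. power_sum q k * mean_fix q (n - Suc k)))"
proof -
  let ?G = "geometric_pmf (1 - q)"
  have eq: "of_nat ((fix_word w)\<^sup>2) = (\<Sum>a. of_nat (fix_letter w a) * of_nat (fix_word w) :: ennreal)" for w :: "nat list"
    by (simp add: suminf_fix_letter power2_eq_square)
  have "(\<integral>\<^sup>+w. of_nat ((fix_word w)\<^sup>2) \<partial>replicate_pmf n ?G)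
      = (\<Sum>a. \<integral>\<^sup>+w. of_nat (fix_letter w a) * of_nat (fix_word w) \<partial>replicate_pmf n ?G)"
    unfolding eq by (rule nn_integral_suminf) simp
  also have "\<dots> = (\<Sum>a. ennreal (cov_fix q n (pmf ?G a)))" by (simp only: nn_integral_fix_letter_fix_word[OF q])
  also have "\<dots> = ennreal ((\<Sum>k<n. real (Suc k) * power_sum q k) + (\<Sum>k<n. power_sum q k * mean_fix q (n - Suc k)))"
  proof (rule suminf_ennreal_eq)
    show "0 \<le> cov_fix q n (pmf ?G a)" for a
      using q mean_fix_nonneg pmf_nonneg[of ?G a] unfolding cov_fix_def
      by (intro add_nonneg_nonneg sum_nonneg mult_nonneg_nonneg zero_le_power) simp_all
    show "(\<lambda>a. cov_fix q n (pmf ?G a)) sums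
        ((\<Sum>k<n. real (Suc k) * power_sum q k) + (\<Sum>k<n. power_sum q k * mean_fix q (n - Suc k)))"
      unfolding cov_fix_def by (intro sums_add sums_sum sums_mult sums_mult2 pmf_geometric_sums q)
  qed
  finally show ?thesis .
qed

lemma nn_integral_swap_word:
  assumes q: "0 < q" "q < 1"
  shows "(\<integral>\<^sup>+w. of_nat (swap_word w) \<partial>replicate_pmf n (geometric_pmf (1 - q)))
    = ennreal (\<Sum>k<n div 2. q ^ Suc k * (1 - q) ^ (2 * k) / (q_int q (Suc k) * q_int q (2 * Suc k)))"
proof -
  let ?G = "geometric_pmf (1 - q)"
  let ?c = "\<lambda>k. (1 - q) ^ (2 * Suc k) * q ^ Suc k * (1 / (1 - q ^ Suc k))"
  have lt: "q ^ m < 1" if "m > 0" for m using q that by (simp add: power_less_one_iff)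
  have "(\<integral>\<^sup>+w. of_nat (swap_word w) \<partial>replicate_pmf n ?G)
      = (\<Sum>a. \<Sum>d. \<integral>\<^sup>+w. of_nat (swap_letters w a (Suc (a + d))) \<partial>replicate_pmf n ?G)"
    unfolding suminf_swap_letters[symmetric] by (subst nn_integral_suminf, simp, subst nn_integral_suminf, simp_all)
  also have "\<dots> = (\<Sum>a. \<Sum>d. ennreal (\<Sum>k<n div 2. (pmf ?G a * pmf ?G (Suc (a + d))) ^ Suc k))"
    by (intro suminf_cong nn_integral_swap_letters) simp
  also have "\<dots> = (\<Sum>a. ennreal (\<Sum>k<n div 2. ?c k * (q ^ (2 * Suc k)) ^ a))"
  proof (intro suminf_cong suminf_ennreal_eq sums_sum)
    \<comment> \<open>For \<open>b = Suc (a + d)\<close> the term factors into powers in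
      \<open>a\<close> and in \<open>d\<close>. The series in \<open>d\<close> has ratio
      \<open>q ^ Suc k\<close>, and the remaining one in \<open>a\<close> has ratio
      \<open>q ^ (2 * Suc k)\<close>; these give the two q-integers. \<open>?c k\<close> is the
      inner sum at \<open>a = 0\<close>.\<close>
    fix a k
    have "(\<lambda>d. ((1 - q) ^ (2 * Suc k) * q ^ Suc k * (q ^ (2 * Suc k)) ^ a) * (q ^ Suc k) ^ d)
        sums (((1 - q) ^ (2 * Suc k) * q ^ Suc k * (q ^ (2 * Suc k)) ^ a) * (1 / (1 - q ^ Suc k)))"
      using q lt by (intro sums_mult geometric_sums) (simp del: power_Suc)
    moreover have "((1 - q) ^ (2 * Suc k) * q ^ Suc k * (q ^ (2 * Suc k)) ^ a) * (q ^ Suc k) ^ d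
        = (pmf ?G a * pmf ?G (Suc (a + d))) ^ Suc k" for d
    proof -
      have "pmf ?G a * pmf ?G (Suc (a + d)) = (1 - q) ^ 2 * q * (q ^ 2) ^ a * q ^ d"
        using q by (simp add: power_add power2_eq_square power_mult_distrib)
      then show ?thesis
        by (simp only: power_mult_distrib) (simp only: power_mult[symmetric] ac_simps)
    qed
    ultimately show "(\<lambda>d. (pmf ?G a * pmf ?G (Suc (a + d))) ^ Suc k) sums (?c k * (q ^ (2 * Suc k)) ^ a)"
      by (simp only: ac_simps)
  qed (intro sum_nonneg zero_le_power mult_nonneg_nonneg pmf_nonneg)
  also have "\<dots> = ennreal (\<Sum>k<n div 2. ?c k * (1 / (1 - q ^ (2 * Suc k))))"
  proof (intro suminf_ennreal_eq sums_sum sums_mult geometric_sums sum_nonneg mult_nonneg_nonneg)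
    show "norm (q ^ (2 * Suc k)) < 1" for k using q lt[of "2 * Suc k"] by (simp del: power_Suc)
    show "0 \<le> 1 / (1 - q ^ Suc k)" for k using lt[of "Suc k"] by simp
  qed (use q in simp_all)
  also have "(\<Sum>k<n div 2. ?c k * (1 / (1 - q ^ (2 * Suc k))))
      = (\<Sum>k<n div 2. q ^ Suc k * (1 - q) ^ (2 * k) / (q_int q (Suc k) * q_int q (2 * Suc k)))"
  proof (intro sum.cong refl)
    fix k
    have "q_int q (Suc k) = (1 - q ^ Suc k) / (1 - q)" "q_int q (2 * Suc k) = (1 - q ^ (2 * Suc k)) / (1 - q)"
      using q by (simp_all only: q_int_eq)
    moreover have "(1 - q) ^ (2 * Suc k) = (1 - q) ^ (2 * k) * ((1 - q) * (1 - q))" by simp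
    moreover have "A * (c * c) * B * (1 / X) * (1 / Y) = B * A / (X / c * (Y / c))" for A B c X Y :: real
      by simp
    ultimately show "?c k * (1 / (1 - q ^ (2 * Suc k)))
        = q ^ Suc k * (1 - q) ^ (2 * k) / (q_int q (Suc k) * q_int q (2 * Suc k))" by (simp only:)
  qed
  finally show ?thesis .
qed

section \<open>Transfer of the moments to the major index distribution\<close>

lemma expectation_eq_of_nn_integral:
  fixes f :: "'a \<Rightarrow> nat"
  assumes "(\<integral>\<^sup>+x. of_nat (f x) \<partial>measure_pmf M) = ennreal r" "0 \<le> r"
  shows "measure_pmf.expectation M (\<lambda>x. real (f x)) = r"
  using assms by (simp add: integral_eq_nn_integral ennreal_of_nat_eq_real_of_nat)

lemma nn_integral_Maj:
  assumes q: "0 < q" "q < 1"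
    and f: "\<And>w. length w = n \<Longrightarrow> f (inv (rank_perm w)) = g w"
  shows "(\<integral>\<^sup>+\<pi>. f \<pi> \<partial>Maj n q) = (\<integral>\<^sup>+w. g w \<partial>replicate_pmf n (geometric_pmf (1 - q)))"
  unfolding map_pmf_inv_rank_perm[OF q, symmetric] nn_integral_map_pmf
  by (intro nn_integral_cong_AE) (simp add: AE_measure_pmf_iff set_replicate_pmf f)

lemma expectation_fixed_points:
  assumes q: "0 < q" "q < 1"
  shows "measure_pmf.expectation (Maj n q) (\<lambda>\<pi>. real (fixed_points n \<pi>)) = mean_fix q n"
proof (rule expectation_eq_of_nn_integral)
  show "(\<integral>\<^sup>+\<pi>. of_nat (fixed_points n \<pi>) \<partial>Maj n q) = ennreal (mean_fix q n)"
    unfolding nn_integral_fix_word[OF q, symmetric]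
    by (rule nn_integral_Maj[OF q]) (auto simp: fixed_points_inv_rank_perm)
qed (rule mean_fix_nonneg[OF q])

lemma expectation_fixed_points_square:
  assumes q: "0 < q" "q < 1"
  shows "measure_pmf.expectation (Maj n q) (\<lambda>\<pi>. (real (fixed_points n \<pi>))\<^sup>2)
    = (\<Sum>k<n. real (Suc k) * power_sum q k) + (\<Sum>k<n. power_sum q k * mean_fix q (n - Suc k))" (is "_ = ?r")
proof -
  have "(\<integral>\<^sup>+\<pi>. of_nat ((fixed_points n \<pi>)\<^sup>2) \<partial>Maj n q) = ennreal ?r"
    unfolding nn_integral_fix_word_square[OF q, symmetric]
    by (rule nn_integral_Maj[OF q]) (auto simp: fixed_points_inv_rank_perm)
  moreover have "0 \<le> ?r"
    by (intro add_nonneg_nonneg sum_nonneg mult_nonneg_nonneg power_sum_nonneg mean_fix_nonneg q) simp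
  ultimately have "measure_pmf.expectation (Maj n q) (\<lambda>\<pi>. real ((fixed_points n \<pi>)\<^sup>2)) = ?r"
    by (rule expectation_eq_of_nn_integral)
  then show ?thesis by simp
qed

lemma finite_set_pmf_Maj: "0 < q \<Longrightarrow> finite (set_pmf (Maj n q))"
  by (rule finite_subset[OF _ finite_permutations[of "{1..n}"]]) (auto simp: set_pmf_iff pmf_Maj split: if_splits)

lemma variance_fixed_points:
  assumes q: "0 < q" "q < 1"
  shows "measure_pmf.variance (Maj n q) (\<lambda>\<pi>. real (fixed_points n \<pi>))
    = (\<Sum>k<n. real (Suc k) * power_sum q k) + (\<Sum>k<n. power_sum q k * mean_fix q (n - Suc k)) - (mean_fix q n)\<^sup>2"
  by (subst measure_pmf.variance_eq)
     (simp_all only: expectation_fixed_points[OF q] expectation_fixed_points_square[OF q]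
       integrable_measure_pmf_finite[OF finite_set_pmf_Maj[OF q(1)]])

lemma expectation_two_cycles:
  assumes q: "0 < q" "q < 1"
  shows "measure_pmf.expectation (Maj n q) (\<lambda>\<pi>. real (two_cycles n \<pi>))
    = (\<Sum>k<n div 2. q ^ Suc k * (1 - q) ^ (2 * k) / (q_int q (Suc k) * q_int q (2 * Suc k)))" (is "_ = ?r")
proof (rule expectation_eq_of_nn_integral)
  show "(\<integral>\<^sup>+\<pi>. of_nat (two_cycles n \<pi>) \<partial>Maj n q) = ennreal ?r"
    unfolding nn_integral_swap_word[OF q, symmetric]
    by (rule nn_integral_Maj[OF q]) (auto simp: two_cycles_inv_rank_perm)
  show "0 \<le> ?r"
    using q by (intro sum_nonneg divide_nonneg_nonneg mult_nonneg_nonneg) (simp_all add: q_int_def sum_nonneg)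
qed

section \<open>The limit of the variance\<close>

lemma summable_power_sum:
  assumes q: "0 < q" "q < 1"
  shows "summable (power_sum q)"
  by (rule summable_comparison_test'[OF summable_geometric[of "1 - q"]])
     (use q power_sum_nonneg power_sum_le in auto)

lemma summable_Suc_power_sum:
  assumes q: "0 < q" "q < 1"
  shows "summable (\<lambda>k. real (Suc k) * power_sum q k)"
proof (rule summable_comparison_test')
  show "summable (\<lambda>k. real (Suc k) * (1 - q) ^ k)"
    using geometric_deriv_sums[of "1 - q"] q by (auto simp: sums_iff)
  show "norm (real (Suc k) * power_sum q k) \<le> real (Suc k) * (1 - q) ^ k" for k
    using power_sum_nonneg[OF q, of k] power_sum_le[OF q, of k] by (simp add: mult_left_mono)
qed

text \<open>Both sides run over the pairs of indices with total less than \<open>n\<close>; grouped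
  by the total, they form a partial sum of a Cauchy product.\<close>

lemma sum_power_sum_mean_fix:
  "(\<Sum>k<Suc n. power_sum q k * mean_fix q (Suc n - Suc k))
    = (\<Sum>m<n. \<Sum>i\<le>m. power_sum q i * power_sum q (m - i))"
proof (induction n)
  case 0
  then show ?case by (simp add: mean_fix_def)
next
  case (Suc n)
  have "(\<Sum>k<Suc (Suc n). power_sum q k * mean_fix q (Suc (Suc n) - Suc k))
      = (\<Sum>k<Suc n. power_sum q k * mean_fix q (Suc (n - k)))"
    by (simp add: mean_fix_def Suc_diff_le)
  also have "\<dots> = (\<Sum>k<Suc n. power_sum q k * mean_fix q (Suc n - Suc k)) + (\<Sum>k<Suc n. power_sum q k * power_sum q (n - k))"
    unfolding sum.distrib[symmetric] by (intro sum.cong refl) (simp add: mean_fix_def algebra_simps)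
  finally show ?case unfolding Suc by (simp flip: lessThan_Suc_atMost)
qed

lemma sum_power_sum_mean_fix_tendsto:
  assumes q: "0 < q" "q < 1"
  shows "(\<lambda>n. \<Sum>k<n. power_sum q k * mean_fix q (n - Suc k)) \<longlonglongrightarrow> (suminf (power_sum q))\<^sup>2"
proof (rule LIMSEQ_imp_Suc)
  have "summable (\<lambda>k. norm (power_sum q k))"
    using summable_power_sum[OF q] power_sum_nonneg[OF q] by simp
  from Cauchy_product_sums[OF this this]
  show "(\<lambda>n. \<Sum>k<Suc n. power_sum q k * mean_fix q (Suc n - Suc k)) \<longlonglongrightarrow> (suminf (power_sum q))\<^sup>2"
    unfolding sum_power_sum_mean_fix by (simp add: sums_def power2_eq_square)
qed

text \<open>The convolution term and the squared mean have the same limit, the square of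
  \<open>suminf (power_sum q)\<close>, and cancel.\<close>

lemma variance_fixed_points_tendsto:
  assumes q: "0 < q" "q < 1"
  shows "(\<lambda>n. measure_pmf.variance (Maj n q) (\<lambda>\<pi>. real (fixed_points n \<pi>)))
    \<longlonglongrightarrow> (\<Sum>k. real (Suc k) * power_sum q k)"
proof -
  have "(\<lambda>n. \<Sum>k<n. real (Suc k) * power_sum q k) \<longlonglongrightarrow> (\<Sum>k. real (Suc k) * power_sum q k)"
    by (rule summable_LIMSEQ[OF summable_Suc_power_sum[OF q]])
  moreover have "(\<lambda>n. mean_fix q n) \<longlonglongrightarrow> suminf (power_sum q)"
    unfolding mean_fix_def by (rule summable_LIMSEQ[OF summable_power_sum[OF q]])
  ultimately have "(\<lambda>n. (\<Sum>k<n. real (Suc k) * power_sum q k)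
      + (\<Sum>k<n. power_sum q k * mean_fix q (n - Suc k)) - (mean_fix q n)\<^sup>2)
    \<longlonglongrightarrow> (\<Sum>k. real (Suc k) * power_sum q k) + (suminf (power_sum q))\<^sup>2 - (suminf (power_sum q))\<^sup>2"
    by (intro tendsto_intros sum_power_sum_mean_fix_tendsto[OF q])
  then show ?thesis unfolding variance_fixed_points[OF q] by simp
qed

text \<open>Nonnegative terms make the series unconditionally summable, and \<open>l = Suc k\<close>
  moves it to the index set \<open>{1..}\<close>.\<close>

lemma has_sum_Suc_power_sum:
  assumes q: "0 < q" "q < 1"
  shows "((\<lambda>l. real l * (1 - q) ^ (l - 1) / q_int q l) has_sum (\<Sum>k. real (Suc k) * power_sum q k)) {1..}"
proof -
  have "((\<lambda>k. real (Suc k) * power_sum q k) has_sum (\<Sum>k. real (Suc k) * power_sum q k)) UNIV"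
    using summable_Suc_power_sum[OF q] power_sum_nonneg[OF q]
    by (intro norm_summable_imp_has_sum) (simp_all add: summable_sums)
  then have "((\<lambda>l. real l * (1 - q) ^ (l - 1) / q_int q l) \<circ> Suc has_sum (\<Sum>k. real (Suc k) * power_sum q k)) UNIV"
    by (simp add: o_def power_sum_def)
  then have "((\<lambda>l. real l * (1 - q) ^ (l - 1) / q_int q l) has_sum (\<Sum>k. real (Suc k) * power_sum q k)) (range Suc)"
    by (subst has_sum_reindex) simp_all
  moreover have "range Suc = {1..}" by (auto simp: image_iff Suc_le_eq gr0_conv_Suc)
  ultimately show ?thesis by (simp only:)
qed

theorem theorem1p5:
  fixes q :: real and n :: nat
  assumes "0 < q" and "q < 1"
  shows "measure_pmf.expectation (Maj n q) (\<lambda>\<pi>. real (fixed_points n \<pi>))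
           = (\<Sum>l=1..n. (1 - q) ^ (l - 1) / q_int q l)
       \<and> (\<lambda>l. real l * (1 - q) ^ (l - 1) / q_int q l) summable_on {1..}
       \<and> (\<lambda>m. measure_pmf.variance (Maj m q) (\<lambda>\<pi>. real (fixed_points m \<pi>)))
           \<longlonglongrightarrow> (\<Sum>\<^sub>\<infinity>l\<in>{1..}. real l * (1 - q) ^ (l - 1) / q_int q l)
       \<and> measure_pmf.expectation (Maj n q) (\<lambda>\<pi>. real (two_cycles n \<pi>))
           = (\<Sum>l=1..n div 2. q ^ l * (1 - q) ^ (2 * l - 2) / (q_int q l * q_int q (2 * l)))"
proof (intro conjI)
  show "measure_pmf.expectation (Maj n q) (\<lambda>\<pi>. real (fixed_points n \<pi>))
      = (\<Sum>l=1..n. (1 - q) ^ (l - 1) / q_int q l)"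
    by (simp add: expectation_fixed_points[OF assms] mean_fix_def power_sum_def sum.atLeast1_atMost_eq)
  show "(\<lambda>l. real l * (1 - q) ^ (l - 1) / q_int q l) summable_on {1..}"
    using has_sum_Suc_power_sum[OF assms] by (rule has_sum_imp_summable)
  show "(\<lambda>m. measure_pmf.variance (Maj m q) (\<lambda>\<pi>. real (fixed_points m \<pi>)))
      \<longlonglongrightarrow> (\<Sum>\<^sub>\<infinity>l\<in>{1..}. real l * (1 - q) ^ (l - 1) / q_int q l)"
    unfolding infsumI[OF has_sum_Suc_power_sum[OF assms]] by (rule variance_fixed_points_tendsto[OF assms])
  show "measure_pmf.expectation (Maj n q) (\<lambda>\<pi>. real (two_cycles n \<pi>))
      = (\<Sum>l=1..n div 2. q ^ l * (1 - q) ^ (2 * l - 2) / (q_int q l * q_int q (2 * l)))"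
    by (simp add: expectation_two_cycles[OF assms] sum.atLeast1_atMost_eq)
qed

end
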